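(* (a) Let $G$ be an $r$-graph (for some integer $r\geq 1$) that is not $(r+1)$-edge-colorable, and suppose $G$ has the minimum number of vertices among all graphs $H$ that, for some integer $s\geq1$, are $s$-graphs which are not $(s+1)$-edge-colorable. Then $G$ is a brick. (b) Let $G$ be an $r$-graph (for some integer $r\geq 1$) that does not contain $2r$ perfect matchings such that each edge of $G$ belongs to precisely two of them, and suppose $G$ has the minimum number of vertices among all graphs $H$ that, for some integer $s\geq 1$, are $s$-graphs not containing $2s$ perfect matchings such that each edge of $H$ belongs to precisely two of them. Then $G$ is a brick.
   Context: All graphs are finite and connected; multiple edges are allowed but loops are not. For $X\subseteq V$, $\partial(X)$ denotes the set of edges with exactly one end in $X$; $X$ is odd if $|X|$ is odd. An $r$-graph is an $r$-regular graph $G=(V,E)$ such that $|\partial(X)|\geq r$ for every odd set $X\subseteq V$. A graph is $k$-edge-colorable if its edges can be colored with $k$ colors so that edges sharing an end receive different colors. A collection of perfect matchings is a list (repetitions allowed). A graph $G$ is bi-critical if $G-u-v$ has a perfect matching for every pair of distinct vertices $u,v$. A brick is a graph that is non-bipartite, bi-critical and $3$-vertex-connected. *)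

theory Defs
  imports Main
begin

text \<open>
  Finite loopless multigraphs. Edges are abstract objects, so parallel edges are distinct
  elements of \<open>edges G\<close> with the same set of ends. The value of \<open>ends G\<close> outside
  \<open>edges G\<close> is irrelevant.
\<close>

record ('v, 'e) multigraph =
  verts :: "'v set"
  edges :: "'e set"
  ends :: "'e \<Rightarrow> 'v set"

definition wf_multigraph :: "('v, 'e) multigraph \<Rightarrow> bool" where
  "wf_multigraph G \<longleftrightarrow>
     finite (verts G) \<and> finite (edges G) \<and>
     (\<forall>e \<in> edges G. ends G e \<subseteq> verts G \<and> card (ends G e) = 2)"

definition adjacency :: "('v, 'e) multigraph \<Rightarrow> ('v \<times> 'v) set" where
  "adjacency G = {(u, v). \<exists>e \<in> edges G. ends G e = {u, v}}"

definition graph_connected :: "('v, 'e) multigraph \<Rightarrow> bool" where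
  "graph_connected G \<longleftrightarrow>
     verts G \<noteq> {} \<and> (\<forall>u \<in> verts G. \<forall>v \<in> verts G. (u, v) \<in> (adjacency G)\<^sup>*)"

definition del_verts :: "('v, 'e) multigraph \<Rightarrow> 'v set \<Rightarrow> ('v, 'e) multigraph" where
  "del_verts G X =
     \<lparr>verts = verts G - X, edges = {e \<in> edges G. ends G e \<inter> X = {}}, ends = ends G\<rparr>"

definition vertex_degree :: "('v, 'e) multigraph \<Rightarrow> 'v \<Rightarrow> nat" where
  "vertex_degree G v = card {e \<in> edges G. v \<in> ends G e}"

definition regular_graph :: "nat \<Rightarrow> ('v, 'e) multigraph \<Rightarrow> bool" where
  "regular_graph r G \<longleftrightarrow> (\<forall>v \<in> verts G. vertex_degree G v = r)"

definition edge_boundary :: "('v, 'e) multigraph \<Rightarrow> 'v set \<Rightarrow> 'e set" where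
  "edge_boundary G X = {e \<in> edges G. card (ends G e \<inter> X) = 1}"

definition r_graph :: "nat \<Rightarrow> ('v, 'e) multigraph \<Rightarrow> bool" where
  "r_graph r G \<longleftrightarrow>
     wf_multigraph G \<and> graph_connected G \<and> regular_graph r G \<and>
     (\<forall>X \<subseteq> verts G. odd (card X) \<longrightarrow> card (edge_boundary G X) \<ge> r)"

definition edge_colorable :: "nat \<Rightarrow> ('v, 'e) multigraph \<Rightarrow> bool" where
  "edge_colorable k G \<longleftrightarrow>
     (\<exists>c :: 'e \<Rightarrow> nat. (\<forall>e \<in> edges G. c e < k) \<and>
        (\<forall>e \<in> edges G. \<forall>f \<in> edges G. e \<noteq> f \<and> ends G e \<inter> ends G f \<noteq> {} \<longrightarrow> c e \<noteq> c f))"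

definition perfect_matching :: "('v, 'e) multigraph \<Rightarrow> 'e set \<Rightarrow> bool" where
  "perfect_matching G M \<longleftrightarrow>
     M \<subseteq> edges G \<and> (\<forall>v \<in> verts G. \<exists>!e. e \<in> M \<and> v \<in> ends G e)"

text \<open>Matchings are collected in a list and counted by position, so repetitions are allowed.\<close>

definition has_double_cover :: "nat \<Rightarrow> ('v, 'e) multigraph \<Rightarrow> bool" where
  "has_double_cover r G \<longleftrightarrow>
     (\<exists>Ms :: 'e set list. length Ms = 2 * r \<and>
        (\<forall>M \<in> set Ms. perfect_matching G M) \<and>
        (\<forall>e \<in> edges G. card {i. i < length Ms \<and> e \<in> Ms ! i} = 2))"

definition bipartite :: "('v, 'e) multigraph \<Rightarrow> bool" where
  "bipartite G \<longleftrightarrow>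
     (\<exists>A B. A \<union> B = verts G \<and> A \<inter> B = {} \<and>
        (\<forall>e \<in> edges G. \<exists>a \<in> A. \<exists>b \<in> B. ends G e = {a, b}))"

definition bicritical :: "('v, 'e) multigraph \<Rightarrow> bool" where
  "bicritical G \<longleftrightarrow>
     (\<forall>u \<in> verts G. \<forall>v \<in> verts G. u \<noteq> v \<longrightarrow> (\<exists>M. perfect_matching (del_verts G {u, v}) M))"

definition vertex_connected :: "nat \<Rightarrow> ('v, 'e) multigraph \<Rightarrow> bool" where
  "vertex_connected k G \<longleftrightarrow>
     card (verts G) > k \<and>
     (\<forall>X \<subseteq> verts G. card X < k \<longrightarrow> graph_connected (del_verts G X))"

definition brick :: "('v, 'e) multigraph \<Rightarrow> bool" where
  "brick G \<longleftrightarrow> wf_multigraph G \<and> \<not> bipartite G \<and> bicritical G \<and> vertex_connected 3 G"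

end

theory Submission
  imports Defs
begin

text \<open>
  Call an odd cut \<open>\<partial>(X)\<close> of size \<open>r\<close> in an \<open>r\<close>-graph tight. Contracting either shore of a tight
  cut gives an \<open>r\<close>-graph again, and edge colorings (or double covers by perfect matchings) of the
  two contractions can be permuted to agree on the cut and then glued. Hence in a minimal
  counterexample every tight cut has a shore of size 1. It is not bipartite either, since regular
  bipartite graphs are \<open>r\<close>-edge-colorable. If \<open>G - u - v\<close> has no perfect matching, Tutte's theorem and
  parity give a set \<open>S\<close> with \<open>u, v \<in> S\<close> such that \<open>G - S\<close> has at least \<open>|S|\<close> odd components. Counting edges
  at \<open>S\<close> shows that each of them spans a tight cut, so all are singletons and \<open>G\<close> is bipartite.
  A vertex cut of size at most 2 similarly produces two disjoint even parts \<open>A\<close> and \<open>B\<close> with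
  \<open>\<partial>(A \<union> {u})\<close> and \<open>\<partial>(A \<union> {v})\<close> both tight and nontrivial, or a barrier of size 2, or an
  isolated part.
\<close>

section \<open>Hall's and Tutte's theorems\<close>

text \<open>Gluing works because of the vertex that replaces a contracted shore: all
  \<open>r\<close> cut edges meet there. A coloring of the contraction therefore gives them
  \<open>r\<close> distinct colors, and a perfect matching of the contraction contains exactly one
  of them; in a double cover each cut edge is chosen at exactly two list positions, on either side.
  So the two shores present the same data on the cut, up to a permutation of colors or of positions.
  Parity drives the rest. Once leftover vertices are collected into the family,
  \<open>card F\<close> and \<open>card S\<close> have the same parity in a vertex set of even size,
  so a violation of Tutte's condition is a surplus of at least two. In G - u - v this surplus pays
  exactly for moving \<open>u\<close> and \<open>v\<close> into \<open>S\<close>. The same surplus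
  argument, applied to a largest \<open>S\<close> attaining equality, derives Tutte's theorem from
  Hall's.\<close>

text \<open>Induction on \<open>I\<close>, split by whether some nonempty proper subfamily
  \<open>K\<close> attains equality in Hall's condition. If so, \<open>K\<close> and the rest are
  matched separately; if not, any single choice \<open>x\<close> for any \<open>i\<close> can be
  fixed.\<close>

lemma hall_marriage:
  assumes "finite I" "\<And>i. i \<in> I \<Longrightarrow> finite (A i)"
    and "\<And>J. J \<subseteq> I \<Longrightarrow> card J \<le> card (\<Union>(A ` J))"
  shows "\<exists>f. inj_on f I \<and> (\<forall>i\<in>I. f i \<in> A i)"
  using assms
proof (induction I arbitrary: A rule: finite_psubset_induct)
  case (psubset I)
  note fin = psubset.prems(1) and cond = psubset.prems(2)
  show ?case
  proof (cases "\<exists>K. K \<noteq> {} \<and> K \<subset> I \<and> card K = card (\<Union>(A ` K))")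
    case True
    then obtain K where K: "K \<noteq> {}" "K \<subset> I" "card K = card (\<Union>(A ` K))" by blast
    define U where "U = \<Union>(A ` K)"
    have finK: "finite K" using K(2) psubset.hyps finite_subset by blast
    have finU: "finite U" unfolding U_def using finK K(2) fin by auto
    have "\<exists>f. inj_on f K \<and> (\<forall>i\<in>K. f i \<in> A i)"
    proof (rule psubset.IH[OF K(2)])
      show "finite (A i)" if "i \<in> K" for i using fin K(2) that by blast
      show "card J \<le> card (\<Union>(A ` J))" if "J \<subseteq> K" for J using cond[of J] K(2) that by blast
    qed
    then obtain f where f: "inj_on f K" "\<forall>i\<in>K. f i \<in> A i" by blast
    \<comment> \<open>Hall's condition survives the removal of the values \<open>U\<close> claimed
      by \<open>K\<close>: apply it to \<open>J \<union> K\<close> and subtract the equality for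
      \<open>K\<close>.\<close>
    have "\<exists>g. inj_on g (I - K) \<and> (\<forall>i\<in>I - K. g i \<in> A i - U)"
    proof (rule psubset.IH)
      show "I - K \<subset> I" using K by blast
      show "finite (A i - U)" if "i \<in> I - K" for i using fin that by auto
      fix J assume J: "J \<subseteq> I - K"
      have finJ: "finite J" using J psubset.hyps finite_subset by blast
      have "card J + card K = card (J \<union> K)"
        using J finJ finK by (intro card_Un_disjoint[symmetric]) auto
      also have "\<dots> \<le> card (\<Union>(A ` (J \<union> K)))" using cond[of "J \<union> K"] J K(2) by blast
      also have "\<Union>(A ` (J \<union> K)) = (\<Union>i\<in>J. A i - U) \<union> U" unfolding U_def by auto
      also have "card \<dots> = card (\<Union>i\<in>J. A i - U) + card U"
        using finJ finU J fin by (intro card_Un_disjoint) auto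
      finally show "card J \<le> card (\<Union>i\<in>J. A i - U)" using K(3) unfolding U_def by simp
    qed
    then obtain g where g: "inj_on g (I - K)" "\<forall>i\<in>I - K. g i \<in> A i - U" by blast
    have "f ` K \<subseteq> U" using f(2) unfolding U_def by auto
    moreover have "g ` (I - K) \<inter> U = {}" using g(2) by auto
    ultimately have "f ` K \<inter> g ` (I - K) = {}" by blast
    then have "inj_on (\<lambda>i. if i \<in> K then f i else g i) (K \<union> (I - K))"
      by (rule inj_on_disjoint_Un[OF f(1) g(1)])
    moreover have "K \<union> (I - K) = I" using K(2) by blast
    ultimately have "inj_on (\<lambda>i. if i \<in> K then f i else g i) I" by simp
    moreover have "\<forall>i\<in>I. (if i \<in> K then f i else g i) \<in> A i" using f(2) g(2) by auto
    ultimately show ?thesis by blast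
  next
    case False
    show ?thesis
    proof (cases "I = {}")
      case True
      then show ?thesis by auto
    next
      case nonempty: False
      then obtain i where i: "i \<in> I" by blast
      have "card {i} \<le> card (A i)" using cond[of "{i}"] i by simp
      then obtain x where x: "x \<in> A i" by fastforce
      have "\<exists>g. inj_on g (I - {i}) \<and> (\<forall>j\<in>I - {i}. g j \<in> A j - {x})"
      proof (rule psubset.IH)
        show "I - {i} \<subset> I" using i by blast
        show "finite (A j - {x})" if "j \<in> I - {i}" for j using fin that by auto
        fix J assume J: "J \<subseteq> I - {i}"
        show "card J \<le> card (\<Union>j\<in>J. A j - {x})"
        proof (cases "J = {}")
          case Jne: False
          \<comment> \<open>\<open>J\<close> omits \<open>i\<close>, so it is a proper subfamily and
            has a value to spare; losing \<open>x\<close> does no harm.\<close>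
          have "card J \<noteq> card (\<Union>(A ` J))" using False Jne J i by blast
          moreover have "card J \<le> card (\<Union>(A ` J))" using cond J by blast
          moreover have "(\<Union>j\<in>J. A j - {x}) = \<Union>(A ` J) - {x}" by auto
          ultimately show ?thesis by (auto simp: card_Diff_singleton_if)
        qed simp
      qed
      then obtain g where g: "inj_on g (I - {i})" "\<forall>j\<in>I - {i}. g j \<in> A j - {x}" by blast
      have "inj_on (g(i := x)) I" using g i
        by (auto simp: inj_on_def)
      moreover have "\<forall>j\<in>I. (g(i := x)) j \<in> A j" using g(2) x by auto
      ultimately show ?thesis by blast
    qed
  qed
qed

text \<open>
  \<open>F\<close> is a family of unions of components of \<open>V - S\<close> rather than of components: this is all that
  the counting arguments need, and it avoids components altogether.
\<close>

definition odd_family :: "'v set set \<Rightarrow> 'v set \<Rightarrow> 'v set \<Rightarrow> 'v set set \<Rightarrow> bool" where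
  "odd_family E V S F \<longleftrightarrow> S \<subseteq> V \<and> pairwise disjnt F \<and>
     (\<forall>A\<in>F. A \<subseteq> V - S \<and> odd (card A) \<and> (\<forall>e\<in>E. e \<subseteq> V \<and> e \<inter> A \<noteq> {} \<longrightarrow> e \<subseteq> A \<union> S))"

text \<open>For a set \<open>E\<close> of pairs, this is a perfect matching of the simple graph
  induced on \<open>V\<close>. Parallel edges are collapsed to their common pair of ends; one edge
  per pair is chosen again later.\<close>

definition set_matching :: "'v set set \<Rightarrow> 'v set \<Rightarrow> 'v set set \<Rightarrow> bool" where
  "set_matching E V M \<longleftrightarrow> M \<subseteq> E \<and> \<Union>M = V \<and> pairwise disjnt M"

lemma odd_family_finite:
  assumes "odd_family E V S F" "finite V"
  shows "finite F" "finite S" "finite (\<Union>F)" "A \<in> F \<Longrightarrow> finite A"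
proof -
  have sub: "F \<subseteq> Pow V" using assms(1) unfolding odd_family_def by auto
  then show "finite F" using assms(2) finite_subset by blast
  show "finite S" using assms by (auto simp: odd_family_def intro: finite_subset)
  have "\<Union>F \<subseteq> V" using sub by auto
  then show "finite (\<Union>F)" using assms(2) by (rule finite_subset)
  show "finite A" if "A \<in> F" using that sub assms(2) finite_subset by blast
qed

lemma even_card_Union_iff:
  assumes "finite F" "pairwise disjnt F" "\<And>A. A \<in> F \<Longrightarrow> odd (card A)"
  shows "even (card (\<Union>F)) \<longleftrightarrow> even (card F)"
proof -
  have "finite A" if "A \<in> F" for A using assms(3)[OF that] card.infinite by fastforce
  then have "card (\<Union>F) = sum card F" using assms(2) by (intro card_Union_disjoint) auto
  moreover have "{A \<in> F. odd (card A)} = F" using assms(3) by auto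
  ultimately show ?thesis using even_sum_iff[OF assms(1), of card] by simp
qed

text \<open>Vertices outside \<open>S\<close> and \<open>F\<close> form one further odd set when their number is odd.\<close>

lemma odd_family_parity:
  assumes "odd_family E V S F" "finite V" "\<And>e. e \<in> E \<Longrightarrow> card e = 2"
  obtains F' where "odd_family E V S F'" "F \<subseteq> F'" "even (card F' + card S + card V)"
proof -
  note fin = odd_family_finite[OF assms(1,2)]
  have F: "S \<subseteq> V" "pairwise disjnt F" "\<And>A. A \<in> F \<Longrightarrow> A \<subseteq> V - S" "\<And>A. A \<in> F \<Longrightarrow> odd (card A)"
    and edge: "\<And>A e. A \<in> F \<Longrightarrow> e \<in> E \<Longrightarrow> e \<subseteq> V \<Longrightarrow> e \<inter> A \<noteq> {} \<Longrightarrow> e \<subseteq> A \<union> S"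
    using assms(1) unfolding odd_family_def by blast+
  define D where "D = V - S - \<Union>F"
  have "V = S \<union> \<Union>F \<union> D" using F unfolding D_def by blast
  then have "card V = card (S \<union> \<Union>F \<union> D)" by simp
  also have "\<dots> = card (S \<union> \<Union>F) + card D"
    using fin assms(2) by (intro card_Un_disjoint) (auto simp: D_def)
  also have "card (S \<union> \<Union>F) = card S + card (\<Union>F)"
    using fin F by (intro card_Un_disjoint) auto
  finally have card: "card V = card S + card (\<Union>F) + card D" .
  have par: "even (card (\<Union>F)) = even (card F)"
    using even_card_Union_iff[OF fin(1) F(2,4)] .
  show thesis
  proof (cases "even (card D)")
    case True
    then have "even (card F + card S + card V)" using card par by presburger
    with that assms(1) show thesis by blast
  next
    case False
    then have "D \<noteq> {}" by auto
    then have notin: "D \<notin> F" unfolding D_def by auto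
    have "odd_family E V S (insert D F)"
      unfolding odd_family_def
    proof (intro conjI ballI impI)
      show "S \<subseteq> V" by fact
      show "pairwise disjnt (insert D F)"
        using F(2) unfolding pairwise_insert D_def disjnt_def by auto
      fix A assume A: "A \<in> insert D F"
      show "A \<subseteq> V - S" "odd (card A)" using A F False unfolding D_def by auto
      fix e assume e: "e \<in> E" "e \<subseteq> V \<and> e \<inter> A \<noteq> {}"
      show "e \<subseteq> A \<union> S"
      proof (cases "A \<in> F")
        case True
        then show ?thesis using edge e by blast
      next
        case False
        then have "A = D" using A by blast
        \<comment> \<open>An edge meeting some \<open>B\<close> in \<open>F\<close> stays inside
          \<open>B \<union> S\<close>, which is disjoint from \<open>D\<close>.\<close>
        then have "e \<inter> B = {}" if "B \<in> F" for B
          using edge[OF that e(1)] e(2) that unfolding D_def by blast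
        then show ?thesis using \<open>A = D\<close> e unfolding D_def by blast
      qed
    qed
    moreover have "card (insert D F) = Suc (card F)" using notin fin(1) by simp
    then have "even (card (insert D F) + card S + card V)"
      using card par False by presburger
    ultimately show thesis using that by blast
  qed
qed

lemma set_matching_UN:
  assumes "\<And>i. i \<in> I \<Longrightarrow> set_matching E (B i) (M i)"
    and "\<And>i j. i \<in> I \<Longrightarrow> j \<in> I \<Longrightarrow> i \<noteq> j \<Longrightarrow> B i \<inter> B j = {}"
  shows "set_matching E (\<Union>(B ` I)) (\<Union>(M ` I))"
  unfolding set_matching_def
proof (intro conjI)
  have M: "M i \<subseteq> E" "\<Union>(M i) = B i" "pairwise disjnt (M i)" if "i \<in> I" for i
    using assms(1)[OF that] unfolding set_matching_def by auto
  show "\<Union>(M ` I) \<subseteq> E" using M(1) by blast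
  have "\<Union>(\<Union>(M ` I)) = (\<Union>i\<in>I. \<Union>(M i))" by blast
  then show "\<Union>(\<Union>(M ` I)) = \<Union>(B ` I)" using M(2) by simp
  show "pairwise disjnt (\<Union>(M ` I))"
  proof (rule pairwiseI)
    fix x y assume "x \<in> \<Union>(M ` I)" "y \<in> \<Union>(M ` I)" and ne: "x \<noteq> y"
    then obtain i j where ij: "i \<in> I" "x \<in> M i" "j \<in> I" "y \<in> M j" by blast
    show "disjnt x y"
    proof (cases "i = j")
      case True
      then show ?thesis using M(3) ij ne unfolding pairwise_def by blast
    next
      case False
      have "x \<subseteq> B i" "y \<subseteq> B j" using M(2) ij by blast+
      then show ?thesis using assms(2)[OF ij(1,3) False] unfolding disjnt_def by blast
    qed
  qed
qed

text \<open>Take a largest \<open>S\<close> that has a family \<open>F\<close> of equal size.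
  Maximality forces \<open>S\<close> and \<open>F\<close> to cover \<open>V\<close> and every member
  of \<open>F\<close> to be matchable after the loss of any one vertex; Hall's theorem then assigns
  to each member its own partner in \<open>S\<close>. The induction shrinks \<open>V\<close> with
  \<open>E\<close> fixed, which is possible because \<open>odd_family\<close> looks only at edges
  inside \<open>V\<close>.\<close>

theorem tutte:
  assumes "finite V" "\<And>e. e \<in> E \<Longrightarrow> card e = 2"
    and "\<And>S F. odd_family E V S F \<Longrightarrow> card F \<le> card S"
  shows "\<exists>M. set_matching E V M"
  using assms(1,3)
proof (induction V rule: finite_psubset_induct)
  case (psubset V)
  note fin = psubset.hyps and tutte = psubset.prems
  have empty: "odd_family E V {} {}" unfolding odd_family_def by auto
  then have "\<exists>F. odd_family E V {} F \<and> card F = card ({} :: 'a set)" by (intro exI[of _ "{}"]) simp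
  moreover have "card S \<le> card V" if "odd_family E V S F" for S F
    using that unfolding odd_family_def by (intro card_mono[OF fin]) simp
  \<comment> \<open>The empty set with the empty family attains equality and \<open>card V\<close>
    bounds every candidate, so a largest one exists.\<close>
  ultimately have "\<exists>S. (\<exists>F. odd_family E V S F \<and> card F = card S) \<and>
      (\<forall>S'. (\<exists>F'. odd_family E V S' F' \<and> card F' = card S') \<longrightarrow> card S' \<le> card S)"
    by (intro ex_has_greatest_nat[of _ "{}" card "Suc (card V)"]) (auto simp: less_Suc_eq_le)
  then obtain S F where SF: "odd_family E V S F" "card F = card S"
    and max: "\<And>S' F'. odd_family E V S' F' \<Longrightarrow> card F' = card S' \<Longrightarrow> card S' \<le> card S"
    by auto
  have max': "card S' \<le> card S" if "odd_family E V S' F'" "card S' \<le> card F'" for S' F'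
    using max[OF that(1)] tutte[OF that(1)] that(2) by simp
  note finF = odd_family_finite[OF SF(1) fin]
  have F: "S \<subseteq> V" "pairwise disjnt F" "\<And>A. A \<in> F \<Longrightarrow> A \<subseteq> V - S" "\<And>A. A \<in> F \<Longrightarrow> odd (card A)"
    and edge: "\<And>A e. A \<in> F \<Longrightarrow> e \<in> E \<Longrightarrow> e \<subseteq> V \<Longrightarrow> e \<inter> A \<noteq> {} \<Longrightarrow> e \<subseteq> A \<union> S"
    using SF(1) unfolding odd_family_def by blast+
  \<comment> \<open>For \<open>S\<close> empty the hypothesis makes the parity-completed family
    empty, so the parity relation is about \<open>card V\<close> alone.\<close>
  have evV: "even (card V)"
  proof -
    obtain F' where F': "odd_family E V {} F'" "even (card F' + card ({}::'a set) + card V)"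
      using odd_family_parity[OF empty fin assms(2)] by blast
    then show ?thesis using tutte[OF F'(1)] by simp
  qed
  have cover: "V = S \<union> \<Union>F"
  proof (rule ccontr)
    assume neq: "V \<noteq> S \<union> \<Union>F"
    define D where "D = V - S - \<Union>F"
    obtain v where v: "v \<in> D" using neq F unfolding D_def by blast
    \<comment> \<open>Moving a leftover vertex into \<open>S\<close> spoils the parity, so
      completing the family must add a member. This restores equality for a larger set, against
      maximality.\<close>
    have "odd_family E V (insert v S) F"
      using SF(1) v unfolding odd_family_def D_def by blast
    then obtain F' where F': "odd_family E V (insert v S) F'" "F \<subseteq> F'"
      "even (card F' + card (insert v S) + card V)"
      using odd_family_parity[OF _ fin assms(2)] by blast
    have cS: "card (insert v S) = Suc (card S)" using v finF unfolding D_def by auto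
    have "card F \<le> card F'" using F'(2) odd_family_finite(1)[OF F'(1) fin] card_mono by blast
    then have "card (insert v S) \<le> card F'" using F'(3) evV cS SF(2) by presburger
    then have "card (insert v S) \<le> card S" using max'[OF F'(1)] by blast
    then show False using cS by simp
  qed
  \<comment> \<open>If \<open>A - {v}\<close> violated the condition, parity would give
    \<open>S1\<close> and \<open>F2\<close> with at least \<open>card S1 + 2\<close> members.
    Trading \<open>A\<close> for \<open>F2\<close> costs one member, while \<open>S\<close> grows by
    \<open>v\<close> and \<open>S1\<close>; the result still has
    \<open>card S3 \<le> card F3\<close>, and \<open>S3\<close> is larger than
    \<open>S\<close>.\<close>
  have critical: "\<exists>M. set_matching E (A - {v}) M" if A: "A \<in> F" and v: "v \<in> A" for A v
  proof (rule psubset.IH)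
    show "A - {v} \<subset> V" using F(3)[OF A] v by blast
    fix S1 F1 assume 1: "odd_family E (A - {v}) S1 F1"
    show "card F1 \<le> card S1"
    proof (rule ccontr)
      assume less: "\<not> card F1 \<le> card S1"
      have finA: "finite (A - {v})" using finF(4)[OF A] by simp
      obtain F2 where F2: "odd_family E (A - {v}) S1 F2" "F1 \<subseteq> F2"
        "even (card F2 + card S1 + card (A - {v}))"
        using odd_family_parity[OF 1 finA assms(2)] by blast
      have evA: "even (card (A - {v}))" using F(4)[OF A] v finF(4)[OF A] by (simp add: card_Diff_singleton_if)
      have "card F1 \<le> card F2" using F2(2) odd_family_finite(1)[OF F2(1) finA] card_mono by blast
      then have big: "card F2 \<ge> card S1 + 2" using less F2(3) evA by presburger
      have F2': "S1 \<subseteq> A - {v}" "pairwise disjnt F2" "\<And>B. B \<in> F2 \<Longrightarrow> B \<subseteq> A - {v} - S1"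
        "\<And>B. B \<in> F2 \<Longrightarrow> odd (card B)"
        and edge2: "\<And>B e. B \<in> F2 \<Longrightarrow> e \<in> E \<Longrightarrow> e \<subseteq> A - {v} \<Longrightarrow> e \<inter> B \<noteq> {} \<Longrightarrow> e \<subseteq> B \<union> S1"
        using F2(1) unfolding odd_family_def by blast+
      define S3 where "S3 = insert v (S \<union> S1)"
      define F3 where "F3 = (F - {A}) \<union> F2"
      have disjA: "A \<inter> B = {}" if "B \<in> F - {A}" for B
        using F(2) A that unfolding pairwise_def disjnt_def by blast
      have 3: "odd_family E V S3 F3"
        unfolding odd_family_def
      proof (intro conjI ballI impI)
        show "S3 \<subseteq> V" using F(1) F(3)[OF A] F2'(1) v unfolding S3_def by blast
        show "pairwise disjnt F3"
        proof (rule pairwiseI)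
          fix x y assume xy: "x \<in> F3" "y \<in> F3" "x \<noteq> y"
          show "disjnt x y"
          proof (cases "x \<in> F2"; cases "y \<in> F2")
            assume "x \<in> F2" "y \<in> F2"
            then show ?thesis using F2'(2) xy unfolding pairwise_def by blast
          next
            assume "x \<in> F2" "y \<notin> F2"
            then show ?thesis using F2'(3)[of x] disjA[of y] xy unfolding F3_def disjnt_def by blast
          next
            assume "x \<notin> F2" "y \<in> F2"
            then show ?thesis using F2'(3)[of y] disjA[of x] xy unfolding F3_def disjnt_def by blast
          next
            assume "x \<notin> F2" "y \<notin> F2"
            then show ?thesis using F(2) xy unfolding pairwise_def F3_def by blast
          qed
        qed
        fix B assume B: "B \<in> F3"
        show "odd (card B)" using B F(4) F2'(4) unfolding F3_def by blast
        show "B \<subseteq> V - S3"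
        proof (cases "B \<in> F2")
          case True
          then show ?thesis using F2'(3)[of B] F(3)[OF A] unfolding S3_def by blast
        next
          case False
          then have "B \<in> F - {A}" using B unfolding F3_def by blast
          then show ?thesis using F(3)[of B] disjA[of B] v F2'(1) unfolding S3_def by blast
        qed
        fix e assume e: "e \<in> E" "e \<subseteq> V \<and> e \<inter> B \<noteq> {}"
        show "e \<subseteq> B \<union> S3"
        proof (cases "B \<in> F2")
          case False
          then show ?thesis using B edge[of B e] e unfolding F3_def S3_def by blast
        next
          case True
          obtain b where b: "b \<in> e" "b \<in> B" using e(2) by blast
          obtain c where c: "e = {b, c}" using assms(2)[OF e(1)] b(1) unfolding card_2_iff by blast
          have bA: "b \<in> A" "b \<noteq> v" using F2'(3)[OF True] b(2) by auto
          then have "c \<in> A \<union> S" using edge[OF A e(1)] e(2) c by blast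
          then consider "c \<in> S" | "c = v" | "c \<in> A - {v}" by blast
          then show ?thesis
          proof cases
            case 3
            then have "e \<subseteq> A - {v}" using c bA by blast
            then have "e \<subseteq> B \<union> S1" using edge2[OF True e(1)] e(2) by blast
            then show ?thesis unfolding S3_def by blast
          qed (use b c in \<open>auto simp: S3_def\<close>)
        qed
      qed
      have nonempty: "B \<noteq> {}" if "B \<in> F2" for B using F2'(4)[OF that] by auto
      have disj: "(F - {A}) \<inter> F2 = {}"
      proof (rule ccontr)
        assume "(F - {A}) \<inter> F2 \<noteq> {}"
        then obtain B where "B \<in> F - {A}" "B \<in> F2" by blast
        then show False using disjA[of B] F2'(3)[of B] nonempty[of B] by blast
      qed
      have finF2: "finite F2" using odd_family_finite(1)[OF F2(1) finA] .
      have "card F3 = card (F - {A}) + card F2"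
        unfolding F3_def using finF(1) finF2 disj by (intro card_Un_disjoint) auto
      moreover have "card F = Suc (card (F - {A}))" using A finF(1) by (metis card_Suc_Diff1)
      moreover have cS3: "card S3 = Suc (card S + card S1)"
      proof -
        have "v \<notin> S \<union> S1" "S \<inter> S1 = {}" using v F(3)[OF A] F2'(1) by blast+
        moreover have "finite S1" using F2'(1) finA finite_subset by blast
        ultimately show ?thesis unfolding S3_def using finF(2) by (simp add: card_Un_disjoint)
      qed
      ultimately have "card S3 \<le> card F3" using big SF(2) by simp
      then have "card S3 \<le> card S" using max'[OF 3] by blast
      then show False using cS3 by simp
    qed
  qed
  define N where "N A = {s \<in> S. \<exists>a\<in>A. {a, s} \<in> E}" for A
  have "\<exists>f. inj_on f F \<and> (\<forall>A\<in>F. f A \<in> N A)"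
  proof (rule hall_marriage)
    show "finite F" by (rule finF)
    show "finite (N A)" for A using finF(2) unfolding N_def by simp
    fix J assume J: "J \<subseteq> F"
    \<comment> \<open>The neighbours of \<open>J\<close> in \<open>S\<close> already separate the
      members of \<open>J\<close>, so Tutte's condition for this smaller set is Hall's condition for
      \<open>J\<close>.\<close>
    have "odd_family E V (\<Union>(N ` J)) J"
      unfolding odd_family_def
    proof (intro conjI ballI impI)
      show "\<Union>(N ` J) \<subseteq> V" using F(1) unfolding N_def by blast
      show "pairwise disjnt J" using F(2) J pairwise_subset by blast
      fix A assume A: "A \<in> J"
      then have AF: "A \<in> F" using J by blast
      show "A \<subseteq> V - \<Union>(N ` J)" using F(3)[OF AF] unfolding N_def by blast
      show "odd (card A)" using F(4)[OF AF] .
      fix e assume e: "e \<in> E" "e \<subseteq> V \<and> e \<inter> A \<noteq> {}"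
      obtain a where a: "a \<in> e" "a \<in> A" using e(2) by blast
      obtain c where c: "e = {a, c}" using assms(2)[OF e(1)] a(1) unfolding card_2_iff by blast
      have "c \<in> A \<or> c \<in> S" using edge[OF AF e(1)] e(2) c by blast
      then show "e \<subseteq> A \<union> \<Union>(N ` J)" using c a e(1) A unfolding N_def by blast
    qed
    then show "card J \<le> card (\<Union>(N ` J))" by (rule tutte)
  qed
  then obtain f where f: "inj_on f F" "\<And>A. A \<in> F \<Longrightarrow> f A \<in> N A" by blast
  \<comment> \<open>Since \<open>card F = card S\<close>, the injection \<open>f\<close> exhausts
    \<open>S\<close>, and the pieces \<open>insert (f A) A\<close> partition
    \<open>V\<close>.\<close>
  have fS: "f ` F = S"
    using f SF(2) finF(2) by (intro card_subset_eq) (auto simp: card_image N_def)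
  have "\<exists>M. set_matching E (insert (f A) A) M" if A: "A \<in> F" for A
  proof -
    obtain a where a: "a \<in> A" "{a, f A} \<in> E" "f A \<in> S" using f(2)[OF A] unfolding N_def by blast
    obtain M where M: "set_matching E (A - {a}) M" using critical[OF A a(1)] by blast
    have "set_matching E (insert (f A) A) (insert {a, f A} M)"
      using M a F(3)[OF A] unfolding set_matching_def pairwise_insert disjnt_def by blast
    then show ?thesis by blast
  qed
  then obtain M where M: "\<And>A. A \<in> F \<Longrightarrow> set_matching E (insert (f A) A) (M A)" by metis
  have "set_matching E (\<Union>A\<in>F. insert (f A) A) (\<Union>(M ` F))"
  proof (rule set_matching_UN)
    fix A B assume AB: "A \<in> F" "B \<in> F" "A \<noteq> B"
    have "A \<inter> B = {}" using F(2) AB unfolding pairwise_def disjnt_def by blast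
    moreover have "f A \<noteq> f B" using f(1) AB unfolding inj_on_def by blast
    moreover have "f A \<in> S" "f B \<in> S" using fS AB by blast+
    ultimately show "insert (f A) A \<inter> insert (f B) B = {}" using F(3)[OF AB(1)] F(3)[OF AB(2)] by blast
  qed (use M in auto)
  moreover have "(\<Union>A\<in>F. insert (f A) A) = V" using cover fS by blast
  ultimately show ?case by auto
qed

section \<open>Contracting and gluing along tight cuts\<close>

lemma card_pair_Int: "a \<noteq> b \<Longrightarrow> card ({a, b} \<inter> X) = 1 \<longleftrightarrow> (a \<in> X) \<noteq> (b \<in> X)"
  by (cases "a \<in> X"; cases "b \<in> X") auto

lemma edge_endsE:
  assumes "wf_multigraph G" "e \<in> edges G"
  obtains a b where "ends G e = {a, b}" "a \<noteq> b" "a \<in> verts G" "b \<in> verts G"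
proof -
  have "card (ends G e) = 2" "ends G e \<subseteq> verts G" using assms unfolding wf_multigraph_def by auto
  then show thesis using that unfolding card_2_iff by blast
qed

lemma edge_boundary_iff:
  assumes "e \<in> edges G" "ends G e = {a, b}" "a \<noteq> b"
  shows "e \<in> edge_boundary G X \<longleftrightarrow> (a \<in> X) \<noteq> (b \<in> X)"
  unfolding edge_boundary_def mem_Collect_eq assms(2) card_pair_Int[OF assms(3)] using assms(1) by blast

lemma edge_boundary_singleton:
  assumes "wf_multigraph G"
  shows "edge_boundary G {v} = {e \<in> edges G. v \<in> ends G e}"
proof (intro set_eqI)
  fix e
  show "e \<in> edge_boundary G {v} \<longleftrightarrow> e \<in> {e \<in> edges G. v \<in> ends G e}"
  proof (cases "e \<in> edges G")
    case True
    then obtain a b where ab: "ends G e = {a, b}" "a \<noteq> b" using edge_endsE[OF assms] by metis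
    show ?thesis unfolding edge_boundary_iff[OF True ab] using True ab by auto
  qed (simp add: edge_boundary_def)
qed

lemma edge_boundary_Diff:
  assumes "wf_multigraph G"
  shows "edge_boundary G (verts G - X) = edge_boundary G X"
proof (intro set_eqI)
  fix e
  show "e \<in> edge_boundary G (verts G - X) \<longleftrightarrow> e \<in> edge_boundary G X"
  proof (cases "e \<in> edges G")
    case True
    then obtain a b where ab: "ends G e = {a, b}" "a \<noteq> b" and "a \<in> verts G" "b \<in> verts G"
      using edge_endsE[OF assms] by metis
    then show ?thesis unfolding edge_boundary_iff[OF True ab] by auto
  qed (simp add: edge_boundary_def)
qed

lemma edge_boundary_subset: "edge_boundary G X \<subseteq> edges G"
  unfolding edge_boundary_def by auto

lemma edge_boundary_edge: "e \<in> edge_boundary G X \<Longrightarrow> e \<in> edges G"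
  by (simp add: edge_boundary_def)

lemma vertex_degree_eq:
  "wf_multigraph G \<Longrightarrow> vertex_degree G v = card (edge_boundary G {v})"
  unfolding vertex_degree_def by (simp add: edge_boundary_singleton)

lemma r_graphD:
  assumes "r_graph r G"
  shows "wf_multigraph G" "finite (verts G)" "finite (edges G)" "graph_connected G"
    "v \<in> verts G \<Longrightarrow> card (edge_boundary G {v}) = r"
    "X \<subseteq> verts G \<Longrightarrow> odd (card X) \<Longrightarrow> r \<le> card (edge_boundary G X)"
proof -
  show wf: "wf_multigraph G" using assms unfolding r_graph_def by blast
  then show "finite (verts G)" "finite (edges G)" unfolding wf_multigraph_def by blast+
  show "graph_connected G" using assms unfolding r_graph_def by blast
  show "card (edge_boundary G {v}) = r" if "v \<in> verts G"
    using assms that wf vertex_degree_eq unfolding r_graph_def regular_graph_def by metis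
  show "r \<le> card (edge_boundary G X)" if "X \<subseteq> verts G" "odd (card X)"
    using assms that unfolding r_graph_def by blast
qed

text \<open>Otherwise the whole vertex set would be an odd set, yet its boundary is empty.\<close>

lemma even_card_verts:
  assumes "r_graph r G" "r \<ge> 1"
  shows "even (card (verts G))"
proof (rule ccontr)
  assume "odd (card (verts G))"
  then have "r \<le> card (edge_boundary G (verts G))" using r_graphD(6)[OF assms(1)] by blast
  moreover have "edge_boundary G (verts G) = edge_boundary G {}"
    using edge_boundary_Diff[OF r_graphD(1)[OF assms(1)], of "{}"] by simp
  moreover have "edge_boundary G {} = {}" by (simp add: edge_boundary_def)
  ultimately show False using assms(2) by simp
qed

lemma odd_complement:
  assumes "r_graph r G" "r \<ge> 1" "X \<subseteq> verts G" "odd (card X)"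
  shows "odd (card (verts G - X))"
proof -
  note fin = r_graphD(2)[OF assms(1)]
  have "card (verts G - X) + card X = card (verts G)"
    using assms(3) fin by (metis add.commute card_Diff_subset card_mono finite_subset le_add_diff_inverse)
  then show ?thesis using even_card_verts[OF assms(1,2)] assms(4) by presburger
qed

section \<open>Contraction along a vertex map and inheritance of the r-graph property\<close>

text \<open>The map \<open>p\<close> identifies vertices and also moves them to a new type. An edge
  whose ends are identified would become a loop and is dropped: its image has one element.
  \<open>q\<close> renames edges, and \<open>ends\<close> is meaningful when \<open>q\<close> is
  injective on the edges.\<close>

definition contract ::
  "('v \<Rightarrow> 'w) \<Rightarrow> ('e \<Rightarrow> 'f) \<Rightarrow> ('v, 'e) multigraph \<Rightarrow> ('w, 'f) multigraph" where
  "contract p q G =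
     \<lparr>verts = p ` verts G, edges = q ` {e \<in> edges G. card (p ` ends G e) = 2},
      ends = (\<lambda>x. p ` ends G (inv_into (edges G) q x))\<rparr>"

lemma verts_contract: "verts (contract p q G) = p ` verts G"
  and edges_contract: "edges (contract p q G) = q ` {e \<in> edges G. card (p ` ends G e) = 2}"
  by (simp_all add: contract_def)

lemma ends_contract:
  "inj_on q (edges G) \<Longrightarrow> e \<in> edges G \<Longrightarrow> ends (contract p q G) (q e) = p ` ends G e"
  by (simp add: contract_def)

lemma wf_contract:
  assumes "wf_multigraph G" "inj_on q (edges G)"
  shows "wf_multigraph (contract p q G)"
  unfolding wf_multigraph_def
proof (intro conjI ballI)
  show "finite (verts (contract p q G))" "finite (edges (contract p q G))"
    using assms(1) unfolding wf_multigraph_def contract_def by auto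
  fix x assume "x \<in> edges (contract p q G)"
  then obtain e where e: "e \<in> edges G" "card (p ` ends G e) = 2" "x = q e"
    unfolding edges_contract by blast
  have "ends G e \<subseteq> verts G" using assms(1) e(1) unfolding wf_multigraph_def by blast
  then show "ends (contract p q G) x \<subseteq> verts (contract p q G)" "card (ends (contract p q G) x) = 2"
    using e ends_contract[OF assms(2) e(1), of p] by (auto simp: verts_contract)
qed

text \<open>No cut edge is lost: a dropped edge has both ends in one fibre of \<open>p\<close>, so
  it never crosses a preimage.\<close>

lemma edge_boundary_contract:
  assumes "wf_multigraph G" "inj_on q (edges G)"
  shows "edge_boundary (contract p q G) Y = q ` edge_boundary G {v \<in> verts G. p v \<in> Y}"
proof -
  let ?H = "contract p q G" and ?X = "{v \<in> verts G. p v \<in> Y}"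
  have key: "card (p ` ends G e) = 2 \<and> card (p ` ends G e \<inter> Y) = 1 \<longleftrightarrow> e \<in> edge_boundary G ?X"
    if e: "e \<in> edges G" for e
  proof -
    obtain a b where ab: "ends G e = {a, b}" "a \<noteq> b" and V: "a \<in> verts G" "b \<in> verts G"
      using edge_endsE[OF assms(1) e] by metis
    show ?thesis
    proof (cases "p a = p b")
      case True
      then show ?thesis unfolding edge_boundary_iff[OF e ab] using ab V by simp
    next
      case False
      then show ?thesis unfolding edge_boundary_iff[OF e ab] 
        using ab V card_pair_Int[OF False, of Y] by simp
    qed
  qed
  have "edge_boundary ?H Y = q ` {e \<in> edges G. card (p ` ends G e) = 2 \<and> card (p ` ends G e \<inter> Y) = 1}"
    unfolding edge_boundary_def edges_contract using ends_contract[OF assms(2), of _ p] by auto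
  also have "\<dots> = q ` edge_boundary G ?X"
    using key edge_boundary_subset[of G ?X] by (intro arg_cong[of _ _ "image q"]) blast
  finally show ?thesis .
qed

lemma connected_contract:
  assumes "wf_multigraph G" "inj_on q (edges G)" "graph_connected G"
  shows "graph_connected (contract p q G)"
proof -
  let ?H = "contract p q G"
  have step: "(p a, p b) \<in> (adjacency ?H)\<^sup>*" if adj: "(a, b) \<in> adjacency G" for a b
  proof (cases "p a = p b")
    case False
    obtain e where e: "e \<in> edges G" "ends G e = {a, b}" using adj unfolding adjacency_def by blast
    then have "q e \<in> edges ?H" using False unfolding edges_contract by auto
    moreover have "ends ?H (q e) = {p a, p b}" using ends_contract[OF assms(2) e(1)] e(2) by simp
    ultimately have "(p a, p b) \<in> adjacency ?H" unfolding adjacency_def by blast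
    then show ?thesis by blast
  qed simp
  have "(p a, p b) \<in> (adjacency ?H)\<^sup>*" if "(a, b) \<in> (adjacency G)\<^sup>*" for a b
    using that by induction (auto intro: rtrancl_trans step)
  then show ?thesis using assms(3) unfolding graph_connected_def verts_contract by auto
qed

text \<open>Odd fibres make the preimage of an odd set odd, and boundaries correspond to boundaries
  of preimages, so the lower bound is inherited. Tightness of the fibres supplies the
  degrees.\<close>

lemma r_graph_contract:
  assumes G: "r_graph r G" and q: "inj_on q (edges G)"
    and odd: "\<And>v. v \<in> verts G \<Longrightarrow> odd (card {u \<in> verts G. p u = p v})"
    and tight: "\<And>v. v \<in> verts G \<Longrightarrow> card (edge_boundary G {u \<in> verts G. p u = p v}) = r"
  shows "r_graph r (contract p q G)"
proof -
  let ?H = "contract p q G"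
  note wf = r_graphD(1)[OF G] and fin = r_graphD(2)[OF G]
  have card: "card (edge_boundary ?H Y) = card (edge_boundary G {v \<in> verts G. p v \<in> Y})" for Y
    unfolding edge_boundary_contract[OF wf q]
    by (intro card_image inj_on_subset[OF q]) (rule edge_boundary_subset)
  have wfH: "wf_multigraph ?H" by (rule wf_contract[OF wf q])
  show ?thesis unfolding r_graph_def
  proof (intro conjI allI impI)
    show "wf_multigraph ?H" by fact
    show "graph_connected ?H" using connected_contract[OF wf q r_graphD(4)[OF G]] .
    show "regular_graph r ?H" unfolding regular_graph_def
    proof
      fix x assume "x \<in> verts ?H"
      then obtain v where v: "v \<in> verts G" "x = p v" unfolding verts_contract by blast
      show "vertex_degree ?H x = r"
        unfolding vertex_degree_eq[OF wfH] card using tight[OF v(1)] v(2) by simp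
    qed
    fix Y assume Y: "Y \<subseteq> verts ?H" "odd (card Y)"
    let ?X = "{v \<in> verts G. p v \<in> Y}"
    have finY: "finite Y" using Y(2) card.infinite by fastforce
    have "card ?X = card (\<Union>y\<in>Y. {v \<in> verts G. p v = y})" by (intro arg_cong[of _ _ card]) auto
    also have "\<dots> = (\<Sum>y\<in>Y. card {v \<in> verts G. p v = y})"
      using finY fin by (intro card_UN_disjoint) auto
    finally have "even (card ?X) \<longleftrightarrow> even (card {y \<in> Y. odd (card {v \<in> verts G. p v = y})})"
      by (simp only: even_sum_iff[OF finY])
    moreover have "{y \<in> Y. odd (card {v \<in> verts G. p v = y})} = Y"
    proof -
      have "odd (card {v \<in> verts G. p v = y})" if "y \<in> Y" for y
      proof -
        obtain u where "u \<in> verts G" "y = p u" using Y(1) \<open>y \<in> Y\<close> unfolding verts_contract by blast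
        then show ?thesis using odd by simp
      qed
      then show ?thesis by blast
    qed
    ultimately have "odd (card ?X)" using Y(2) by simp
    then show "r \<le> card (edge_boundary ?H Y)" unfolding card using r_graphD(6)[OF G] by simp
  qed
qed

text \<open>For a shore \<open>X\<close> these are the edges that survive when the complement of
  \<open>X\<close> is contracted.\<close>

definition incident_edges :: "('v, 'e) multigraph \<Rightarrow> 'v set \<Rightarrow> 'e set" where
  "incident_edges G X = {e \<in> edges G. ends G e \<inter> X \<noteq> {}}"

lemma incident_Int_Diff:
  assumes "wf_multigraph G"
  shows "incident_edges G X \<inter> incident_edges G (verts G - X) = edge_boundary G X"
    and "incident_edges G X \<union> incident_edges G (verts G - X) = edges G"
proof -
  have *: "(e \<in> incident_edges G X \<and> e \<in> incident_edges G (verts G - X) \<longleftrightarrow> e \<in> edge_boundary G X) \<and>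
      (e \<in> incident_edges G X \<or> e \<in> incident_edges G (verts G - X))" if e: "e \<in> edges G" for e
  proof -
    obtain a b where ab: "ends G e = {a, b}" "a \<noteq> b" and V: "a \<in> verts G" "b \<in> verts G"
      using edge_endsE[OF assms e] by metis
    show ?thesis unfolding edge_boundary_iff[OF e ab] incident_edges_def using e ab V by auto
  qed
  show "incident_edges G X \<inter> incident_edges G (verts G - X) = edge_boundary G X"
    "incident_edges G X \<union> incident_edges G (verts G - X) = edges G"
    using * edge_boundary_subset[of G X] unfolding incident_edges_def by blast+
qed

text \<open>\<open>H\<close> arises by contracting the complement of \<open>X\<close> to the vertex \<open>w\<close>;
  \<open>h\<close> and \<open>q\<close> rename the remaining vertices and edges.\<close>

lemma contract_shore:
  fixes G :: "('v, 'e) multigraph"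
  assumes G: "r_graph r G" "r \<ge> 1"
    and X: "X \<subset> verts G" "odd (card X)" "card (edge_boundary G X) = r"
  obtains H :: "(nat, nat) multigraph" and q h w where
    "r_graph r H" "card (verts H) = card X + 1" "inj_on q (edges G)"
    "edges H = q ` incident_edges G X" "h ` X \<subseteq> verts H" "w \<in> verts H"
    "\<And>v e. v \<in> X \<Longrightarrow> e \<in> incident_edges G X \<Longrightarrow> h v \<in> ends H (q e) \<longleftrightarrow> v \<in> ends G e"
    "\<And>e. e \<in> incident_edges G X \<Longrightarrow> w \<in> ends H (q e) \<longleftrightarrow> e \<in> edge_boundary G X"
proof -
  note wf = r_graphD(1)[OF G(1)] and fin = r_graphD(2,3)[OF G(1)]
  obtain z where z: "z \<in> verts G" "z \<notin> X" using X(1) by blast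
  \<comment> \<open>Minimality is stated for graphs on natural numbers, so the contraction is
    carried over to that type.\<close>
  obtain h :: "'v \<Rightarrow> nat" where h: "inj_on h (verts G)"
    using finite_imp_inj_to_nat_seg[OF fin(1)] by blast
  obtain q :: "'e \<Rightarrow> nat" where q: "inj_on q (edges G)"
    using finite_imp_inj_to_nat_seg[OF fin(2)] by blast
  \<comment> \<open>\<open>z\<close> is an arbitrary representative of the complement;
    \<open>h z\<close> serves as the contracted vertex \<open>w\<close>.\<close>
  define p where "p v = h (if v \<in> X then v else z)" for v
  have p_eq: "p u = p v \<longleftrightarrow> u = v \<or> u \<notin> X \<and> v \<notin> X" if "u \<in> verts G" "v \<in> verts G" for u v
    using h that z unfolding p_def inj_on_def by auto
  have fib: "{u \<in> verts G. p u = p v} = (if v \<in> X then {v} else verts G - X)" if "v \<in> verts G" for v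
    using p_eq[OF _ that] that X(1) by auto
  have finX: "finite X" using X(1) fin(1) finite_subset by blast
  have oddc: "odd (card (verts G - X))" using odd_complement[OF G psubset_imp_subset[OF X(1)] X(2)] .
  let ?H = "contract p q G"
  have rH: "r_graph r ?H"
  proof (rule r_graph_contract[OF G(1) q])
    fix v assume v: "v \<in> verts G"
    show "odd (card {u \<in> verts G. p u = p v})" unfolding fib[OF v] using oddc by simp
    show "card (edge_boundary G {u \<in> verts G. p u = p v}) = r"
      unfolding fib[OF v] using r_graphD(5)[OF G(1) v] X(3) edge_boundary_Diff[OF wf] by simp
  qed
  have inc: "(card (p ` ends G e) = 2) = (ends G e \<inter> X \<noteq> {})" if e: "e \<in> edges G" for e
  proof -
    obtain a b where ab: "ends G e = {a, b}" "a \<noteq> b" and V: "a \<in> verts G" "b \<in> verts G"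
      using edge_endsE[OF wf e] by metis
    show ?thesis using p_eq[OF V] ab by (cases "p a = p b") auto
  qed
  have verts: "verts ?H = insert (h z) (h ` X)"
    unfolding verts_contract p_def using z X(1) by auto
  have hz: "h z \<notin> h ` X" using h z X(1) unfolding inj_on_def by blast
  have inXV: "v \<in> verts G" if "v \<in> X" for v using that X(1) by blast
  show thesis
  proof
    show "r_graph r ?H" by fact
    have "inj_on h X" using h X(1) by (blast intro: inj_on_subset)
    then show "card (verts ?H) = card X + 1" unfolding verts using hz finX by (simp add: card_image)
    show "inj_on q (edges G)" by fact
    show "edges ?H = q ` incident_edges G X"
      unfolding edges_contract incident_edges_def using inc by (intro arg_cong[of _ _ "image q"]) blast
    show "h ` X \<subseteq> verts ?H" "h z \<in> verts ?H" unfolding verts by auto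
    fix e assume "e \<in> incident_edges G X"
    then have e: "e \<in> edges G" "ends G e \<inter> X \<noteq> {}" unfolding incident_edges_def by auto
    obtain a b where ab: "ends G e = {a, b}" "a \<noteq> b" and V: "a \<in> verts G" "b \<in> verts G"
      using edge_endsE[OF wf e(1)] by metis
    have ends: "ends ?H (q e) = {p a, p b}" using ends_contract[OF q e(1)] ab by simp
    have pz: "h z = p u \<longleftrightarrow> u \<notin> X" if "u \<in> verts G" for u
      using h z that unfolding p_def inj_on_def by auto
    show "h z \<in> ends ?H (q e) \<longleftrightarrow> e \<in> edge_boundary G X"
      unfolding ends edge_boundary_iff[OF e(1) ab] using e(2) pz V ab(1) by auto
    fix v assume v: "v \<in> X"
    have "h v = p u \<longleftrightarrow> v = u" if "u \<in> verts G" for u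
      using h z that inXV[OF v] v unfolding p_def inj_on_def by auto
    then show "h v \<in> ends ?H (q e) \<longleftrightarrow> v \<in> ends G e" unfolding ends ab(1) using V by simp
  qed
qed

section \<open>Gluing edge colorings\<close>

text \<open>The vertexwise form suits gluing: all edges at a vertex belong to the shore containing
  that vertex, so the condition can be checked on one side at a time.\<close>

lemma edge_colorable_iff:
  assumes "wf_multigraph G"
  shows "edge_colorable k G \<longleftrightarrow>
    (\<exists>c. c ` edges G \<subseteq> {..<k} \<and> (\<forall>v\<in>verts G. inj_on c {e \<in> edges G. v \<in> ends G e}))"
proof
  assume "edge_colorable k G"
  then obtain c :: "'b \<Rightarrow> nat" where c: "\<forall>e\<in>edges G. c e < k"
    "\<forall>e\<in>edges G. \<forall>f\<in>edges G. e \<noteq> f \<and> ends G e \<inter> ends G f \<noteq> {} \<longrightarrow> c e \<noteq> c f"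
    unfolding edge_colorable_def by blast
  have "c ` edges G \<subseteq> {..<k}" using c(1) by blast
  moreover have "inj_on c {e \<in> edges G. v \<in> ends G e}" for v
    using c(2) unfolding inj_on_def by blast
  ultimately show "\<exists>c. c ` edges G \<subseteq> {..<k} \<and> (\<forall>v\<in>verts G. inj_on c {e \<in> edges G. v \<in> ends G e})"
    by blast
next
  assume "\<exists>c. c ` edges G \<subseteq> {..<k} \<and> (\<forall>v\<in>verts G. inj_on c {e \<in> edges G. v \<in> ends G e})"
  then obtain c :: "'b \<Rightarrow> nat" where c: "c ` edges G \<subseteq> {..<k}"
    "\<forall>v\<in>verts G. inj_on c {e \<in> edges G. v \<in> ends G e}" by blast
  have "c e \<noteq> c f" if ef: "e \<in> edges G" "f \<in> edges G" "e \<noteq> f" "ends G e \<inter> ends G f \<noteq> {}" for e f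
  proof -
    obtain v where v: "v \<in> ends G e" "v \<in> ends G f" using ef(4) by blast
    then have "v \<in> verts G" using assms ef(1) unfolding wf_multigraph_def by blast
    then show ?thesis using c(2) ef v unfolding inj_on_def by blast
  qed
  moreover have "\<forall>e\<in>edges G. c e < k" using c(1) by blast
  ultimately show "edge_colorable k G" unfolding edge_colorable_def by blast
qed

text \<open>Pull a coloring of the contraction back along \<open>q\<close>. The cut edges receive
  distinct colors because they all meet at \<open>w\<close>.\<close>

lemma shore_coloring:
  fixes G :: "('v, 'e) multigraph"
  assumes G: "r_graph r G" "r \<ge> 1"
    and X: "X \<subset> verts G" "odd (card X)" "card (edge_boundary G X) = r"
    and col: "\<And>H :: (nat, nat) multigraph. r_graph r H \<Longrightarrow> card (verts H) = card X + 1 \<Longrightarrow> edge_colorable k H"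
  obtains c :: "'e \<Rightarrow> nat" where "c ` incident_edges G X \<subseteq> {..<k}"
    "\<And>v. v \<in> X \<Longrightarrow> inj_on c {e \<in> edges G. v \<in> ends G e}" "inj_on c (edge_boundary G X)"
proof -
  obtain H :: "(nat, nat) multigraph" and q h w where H: "r_graph r H" "card (verts H) = card X + 1"
    and q: "inj_on q (edges G)" and E: "edges H = q ` incident_edges G X" and h: "h ` X \<subseteq> verts H"
    and w: "w \<in> verts H"
    and ends: "\<And>v e. v \<in> X \<Longrightarrow> e \<in> incident_edges G X \<Longrightarrow> h v \<in> ends H (q e) \<longleftrightarrow> v \<in> ends G e"
      "\<And>e. e \<in> incident_edges G X \<Longrightarrow> w \<in> ends H (q e) \<longleftrightarrow> e \<in> edge_boundary G X"
    by (rule contract_shore[OF G X]) (rule that)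
  obtain c where c: "c ` edges H \<subseteq> {..<k}"
      "\<forall>v\<in>verts H. inj_on c {e \<in> edges H. v \<in> ends H e}"
    using col[OF H] edge_colorable_iff[OF r_graphD(1)[OF H(1)]] by blast
  have inj: "inj_on (c \<circ> q) Z" if "x \<in> verts H" "Z \<subseteq> incident_edges G X" "\<And>e. e \<in> Z \<Longrightarrow> x \<in> ends H (q e)"
    for x Z
  proof (rule comp_inj_on)
    have "Z \<subseteq> edges G" using that(2) unfolding incident_edges_def by blast
    then show "inj_on q Z" using q inj_on_subset by blast
    have "q ` Z \<subseteq> {e \<in> edges H. x \<in> ends H e}" using that(2,3) E by blast
    then show "inj_on c (q ` Z)" using c(2) that(1) inj_on_subset by blast
  qed
  show thesis
  proof
    show "(c \<circ> q) ` incident_edges G X \<subseteq> {..<k}" using c(1) E by (simp add: image_comp)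
    show "inj_on (c \<circ> q) {e \<in> edges G. v \<in> ends G e}" if "v \<in> X" for v
    proof (rule inj[of "h v"])
      show "h v \<in> verts H" using h that by blast
      show inc: "{e \<in> edges G. v \<in> ends G e} \<subseteq> incident_edges G X"
        using that unfolding incident_edges_def by blast
      show "h v \<in> ends H (q e)" if "e \<in> {e \<in> edges G. v \<in> ends G e}" for e
        using ends(1)[OF \<open>v \<in> X\<close>] inc that by blast
    qed
    have "edge_boundary G X \<subseteq> incident_edges G X"
      using incident_Int_Diff(1)[OF r_graphD(1)[OF G(1)]] by blast
    then show "inj_on (c \<circ> q) (edge_boundary G X)" using inj[OF w] ends(2) by blast
  qed
qed

text \<open>The images of \<open>B\<close> under \<open>f\<close> and \<open>g\<close> have equal
  size, hence so have their complements in \<open>C\<close>; the forced assignment of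
  \<open>f b\<close> to \<open>g b\<close> therefore extends to a permutation of
  \<open>C\<close>.\<close>

lemma align_injections:
  assumes "inj_on f B" "inj_on g B" "f ` B \<subseteq> C" "g ` B \<subseteq> C" "finite C"
  obtains p where "inj_on p C" "p ` C \<subseteq> C" "\<And>b. b \<in> B \<Longrightarrow> p (g b) = f b"
proof -
  define s where "s = f \<circ> inv_into B g"
  have finB: "finite (f ` B)" "finite (g ` B)" using assms finite_subset by blast+
  have "card (C - g ` B) = card (C - f ` B)"
    using assms finB by (simp add: card_Diff_subset card_image)
  then obtain t where t: "bij_betw t (C - g ` B) (C - f ` B)"
    using finite_same_card_bij assms(5) by blast
  have s: "s (g b) = f b" if "b \<in> B" for b using that assms(2) unfolding s_def by simp
  have "bij_betw (inv_into B g) (g ` B) B" using assms(2) by (intro bij_betw_inv_into) (simp add: bij_betw_def)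
  then have sb: "bij_betw s (g ` B) (f ` B)" unfolding s_def
    by (rule bij_betw_trans) (simp add: assms(1) bij_betw_def)
  define p where "p x = (if x \<in> g ` B then s x else t x)" for x
  have "bij_betw p (g ` B \<union> (C - g ` B)) (f ` B \<union> (C - f ` B))"
    unfolding p_def using sb t by (intro bij_betw_disjoint_Un) auto
  moreover have "g ` B \<union> (C - g ` B) = C" "f ` B \<union> (C - f ` B) = C" using assms by blast+
  ultimately have "bij_betw p C C" by simp
  moreover have "p (g b) = f b" if "b \<in> B" for b using s that unfolding p_def by simp
  ultimately show thesis using that[of p] unfolding bij_betw_def by blast
qed

text \<open>Both shore colorings are injective on the cut, so permuting the colors of one makes them
  agree there. At each vertex the merged coloring is then one of the two.\<close>

lemma merge_coloring:
  fixes G :: "('v, 'e) multigraph"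
  assumes G: "r_graph r G" "r \<ge> 1"
    and X: "X \<subset> verts G" "odd (card X)" "card (edge_boundary G X) = r"
    and col: "\<And>H :: (nat, nat) multigraph. r_graph r H \<Longrightarrow>
      card (verts H) = card X + 1 \<or> card (verts H) = card (verts G - X) + 1 \<Longrightarrow> edge_colorable k H"
  shows "edge_colorable k G"
proof -
  let ?Y = "verts G - X" and ?B = "edge_boundary G X"
  note wf = r_graphD(1)[OF G(1)]
  note bd = edge_boundary_Diff[OF wf, of X]
  have "X \<noteq> {}" using X(2) by auto
  then have Y: "?Y \<subset> verts G" "odd (card ?Y)" "card (edge_boundary G ?Y) = r"
    using X bd odd_complement[OF G psubset_imp_subset[OF X(1)] X(2)] by auto
  have colX: "edge_colorable k H" if "r_graph r H" "card (verts H) = card X + 1"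
    for H :: "(nat, nat) multigraph" using col that by blast
  have colY: "edge_colorable k H" if "r_graph r H" "card (verts H) = card ?Y + 1"
    for H :: "(nat, nat) multigraph" using col that by blast
  obtain c where c: "c ` incident_edges G X \<subseteq> {..<k}"
    "\<And>v. v \<in> X \<Longrightarrow> inj_on c {e \<in> edges G. v \<in> ends G e}" "inj_on c ?B"
    by (rule shore_coloring[OF G X colX]) (assumption+, rule that)
  obtain d where d: "d ` incident_edges G ?Y \<subseteq> {..<k}"
    "\<And>v. v \<in> ?Y \<Longrightarrow> inj_on d {e \<in> edges G. v \<in> ends G e}" "inj_on d ?B"
    by (rule shore_coloring[OF G Y colY, unfolded bd]) (assumption+, rule that)
  note inc = incident_Int_Diff[OF wf, of X]
  have sub: "c ` ?B \<subseteq> {..<k}" "d ` ?B \<subseteq> {..<k}" using c(1) d(1) inc(1) by blast+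
  obtain p where p: "inj_on p {..<k}" "p ` {..<k} \<subseteq> {..<k}" "\<And>e. e \<in> ?B \<Longrightarrow> p (d e) = c e"
    by (rule align_injections[OF c(3) d(3) sub finite_lessThan]) (rule that)
  define m where "m e = (if e \<in> incident_edges G X then c e else p (d e))" for e
  \<comment> \<open>Agreement on the cut lets \<open>m\<close> be read as \<open>p \<circ> d\<close>
    on every edge touching the other shore, although its definition gives precedence to
    \<open>c\<close>.\<close>
  have mY: "m e = p (d e)" if "e \<in> incident_edges G ?Y" for e
  proof (cases "e \<in> incident_edges G X")
    case True
    then have "e \<in> ?B" using that inc(1) by blast
    then show ?thesis using True p(3) unfolding m_def by simp
  qed (simp add: m_def)
  have "m ` edges G \<subseteq> {..<k}"
  proof
    fix x assume "x \<in> m ` edges G"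
    then obtain e where e: "e \<in> edges G" "x = m e" by blast
    show "x \<in> {..<k}"
    proof (cases "e \<in> incident_edges G X")
      case True
      then show ?thesis using c(1) e unfolding m_def by auto
    next
      case False
      then have "e \<in> incident_edges G ?Y" using inc(2) e(1) by blast
      then show ?thesis using d(1) p(2) mY e(2) by auto
    qed
  qed
  moreover have "inj_on m {e \<in> edges G. v \<in> ends G e}" if v: "v \<in> verts G" for v
  proof (cases "v \<in> X")
    case True
    have "inj_on m {e \<in> edges G. v \<in> ends G e} \<longleftrightarrow> inj_on c {e \<in> edges G. v \<in> ends G e}"
      by (rule inj_on_cong) (use True in \<open>auto simp: m_def incident_edges_def\<close>)
    then show ?thesis using c(2) True by blast
  next
    case False
    have sub: "{e \<in> edges G. v \<in> ends G e} \<subseteq> incident_edges G ?Y"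
      using False v unfolding incident_edges_def by blast
    have "inj_on (p \<circ> d) {e \<in> edges G. v \<in> ends G e}"
    proof (rule comp_inj_on)
      show "inj_on d {e \<in> edges G. v \<in> ends G e}" using d(2) False v by blast
      have "d ` {e \<in> edges G. v \<in> ends G e} \<subseteq> {..<k}" using sub d(1) by blast
      then show "inj_on p (d ` {e \<in> edges G. v \<in> ends G e})" using p(1) inj_on_subset by blast
    qed
    moreover have "inj_on m {e \<in> edges G. v \<in> ends G e} \<longleftrightarrow> inj_on (p \<circ> d) {e \<in> edges G. v \<in> ends G e}"
      by (rule inj_on_cong) (use sub mY in auto)
    ultimately show ?thesis by blast
  qed
  ultimately show ?thesis unfolding edge_colorable_iff[OF wf] by (intro exI[of _ m] conjI ballI)
qed

section \<open>Gluing double covers\<close>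

text \<open>Fibres over the same value have equal size; choose a bijection for each value and join
  them.\<close>

lemma align_equal_fibers:
  assumes "finite I" "\<And>b. card {i \<in> I. f i = b} = card {i \<in> I. g i = b}"
  obtains s where "bij_betw s I I" "\<And>i. i \<in> I \<Longrightarrow> g (s i) = f i"
proof -
  have "\<exists>t. bij_betw t {i \<in> I. f i = b} {i \<in> I. g i = b}" for b
    by (rule finite_same_card_bij) (use assms in auto)
  then obtain t where t: "\<And>b. bij_betw (t b) {i \<in> I. f i = b} {i \<in> I. g i = b}" by metis
  define s where "s i = t (f i) i" for i
  have s: "s i \<in> I \<and> g (s i) = f i" if "i \<in> I" for i
    using bij_betwE[OF t[of "f i"]] that unfolding s_def by blast
  have "inj_on s I"
  proof (rule inj_onI)
    fix i j assume ij: "i \<in> I" "j \<in> I" "s i = s j"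
    then have "f i = f j" using s by metis
    then show "i = j" using ij t[of "f i"] unfolding s_def bij_betw_def inj_on_def by auto
  qed
  moreover have "s ` I \<subseteq> I" using s by blast
  ultimately have "bij_betw s I I" using assms(1) by (simp add: bij_betw_def endo_inj_surj)
  then show thesis using that s by blast
qed

text \<open>\<open>N i\<close> is the pullback of the i-th matching of the contraction, and
  \<open>b i\<close> is the edge by which that matching covers the contracted vertex
  \<open>w\<close>.\<close>

lemma shore_double_cover:
  fixes G :: "('v, 'e) multigraph"
  assumes G: "r_graph r G" "r \<ge> 1"
    and X: "X \<subset> verts G" "odd (card X)" "card (edge_boundary G X) = r"
    and cov: "\<And>H :: (nat, nat) multigraph. r_graph r H \<Longrightarrow> card (verts H) = card X + 1 \<Longrightarrow> has_double_cover r H"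
  obtains N :: "nat \<Rightarrow> 'e set" and b where
    "\<And>i. i < 2 * r \<Longrightarrow> N i \<subseteq> incident_edges G X"
    "\<And>i v. i < 2 * r \<Longrightarrow> v \<in> X \<Longrightarrow> \<exists>!e. e \<in> N i \<and> v \<in> ends G e"
    "\<And>i. i < 2 * r \<Longrightarrow> N i \<inter> edge_boundary G X = {b i}"
    "\<And>e. e \<in> incident_edges G X \<Longrightarrow> card {i. i < 2 * r \<and> e \<in> N i} = 2"
proof -
  obtain H :: "(nat, nat) multigraph" and q h w where H: "r_graph r H" "card (verts H) = card X + 1"
    and q: "inj_on q (edges G)" and E: "edges H = q ` incident_edges G X" and h: "h ` X \<subseteq> verts H"
    and w: "w \<in> verts H"
    and ends: "\<And>v e. v \<in> X \<Longrightarrow> e \<in> incident_edges G X \<Longrightarrow> h v \<in> ends H (q e) \<longleftrightarrow> v \<in> ends G e"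
      "\<And>e. e \<in> incident_edges G X \<Longrightarrow> w \<in> ends H (q e) \<longleftrightarrow> e \<in> edge_boundary G X"
    by (rule contract_shore[OF G X]) (rule that)
  obtain Ms where Ms: "length Ms = 2 * r" "\<And>M. M \<in> set Ms \<Longrightarrow> perfect_matching H M"
    "\<And>e. e \<in> edges H \<Longrightarrow> card {i. i < length Ms \<and> e \<in> Ms ! i} = 2"
    using cov[OF H] unfolding has_double_cover_def by blast
  define N where "N i = {e \<in> incident_edges G X. q e \<in> Ms ! i}" for i
  have inj: "e = f" if "q e = q f" "e \<in> incident_edges G X" "f \<in> incident_edges G X" for e f
    using that q unfolding incident_edges_def inj_on_def by blast
  have ex1: "\<exists>!e. e \<in> N i \<and> x \<in> ends H (q e)" if "i < 2 * r" "x \<in> verts H" for i x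
  proof -
    have "perfect_matching H (Ms ! i)" using Ms(1,2) that(1) by simp
    then have M: "Ms ! i \<subseteq> edges H" "\<exists>!e. e \<in> Ms ! i \<and> x \<in> ends H e"
      using that(2) unfolding perfect_matching_def by blast+
    then obtain y where y: "y \<in> Ms ! i" "x \<in> ends H y" "\<And>y'. y' \<in> Ms ! i \<Longrightarrow> x \<in> ends H y' \<Longrightarrow> y' = y"
      by blast
    obtain e where e: "e \<in> incident_edges G X" "y = q e" using M(1) y(1) E by blast
    show ?thesis
    proof (rule ex1I[of _ e])
      show "e \<in> N i \<and> x \<in> ends H (q e)" using e y unfolding N_def by blast
      fix f assume f: "f \<in> N i \<and> x \<in> ends H (q f)"
      then have "q f = q e" using y(3) e unfolding N_def by blast
      then show "f = e" using inj e f unfolding N_def by blast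
    qed
  qed
  have NX: "N i \<subseteq> incident_edges G X" for i unfolding N_def by blast
  have "\<exists>e. N i \<inter> edge_boundary G X = {e}" if i: "i < 2 * r" for i
  proof -
    obtain e where e: "e \<in> N i" "w \<in> ends H (q e)"
      and uniq: "\<And>f. f \<in> N i \<Longrightarrow> w \<in> ends H (q f) \<Longrightarrow> f = e"
      using ex1[OF i w] by auto
    have key: "w \<in> ends H (q f) \<longleftrightarrow> f \<in> edge_boundary G X" if "f \<in> N i" for f
      using ends(2) NX that by blast
    have "N i \<inter> edge_boundary G X \<subseteq> {e}" using key uniq by blast
    moreover have "e \<in> N i \<inter> edge_boundary G X" using key[OF e(1)] e by blast
    ultimately show ?thesis by blast
  qed
  then obtain b where b: "\<And>i. i < 2 * r \<Longrightarrow> N i \<inter> edge_boundary G X = {b i}" by metis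
  show thesis
  proof (rule that[of N b])
    fix i assume i: "i < 2 * r"
    show "N i \<subseteq> incident_edges G X" by fact
    show "N i \<inter> edge_boundary G X = {b i}" using b i .
    show "\<exists>!e. e \<in> N i \<and> v \<in> ends G e" if v: "v \<in> X" for v
    proof -
      have "h v \<in> verts H" using h v by blast
      then have "\<exists>!e. e \<in> N i \<and> h v \<in> ends H (q e)" by (rule ex1[OF i])
      moreover have "e \<in> N i \<and> h v \<in> ends H (q e) \<longleftrightarrow> e \<in> N i \<and> v \<in> ends G e" for e
        using ends(1)[OF v] NX[of i] by blast
      ultimately show ?thesis by simp
    qed
  next
    fix e assume e: "e \<in> incident_edges G X"
    then have "{i. i < 2 * r \<and> e \<in> N i} = {i. i < length Ms \<and> q e \<in> Ms ! i}"
      unfolding N_def Ms(1) by blast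
    then show "card {i. i < 2 * r \<and> e \<in> N i} = 2" using Ms(3) e E by simp
  qed
qed

text \<open>Matchings from the two shores can be united when they use the same cut edge. Each cut
  edge is used twice on both sides, so the positions can be paired accordingly.\<close>

lemma merge_double_cover:
  fixes G :: "('v, 'e) multigraph"
  assumes G: "r_graph r G" "r \<ge> 1"
    and X: "X \<subset> verts G" "odd (card X)" "card (edge_boundary G X) = r"
    and cov: "\<And>H :: (nat, nat) multigraph. r_graph r H \<Longrightarrow>
      card (verts H) = card X + 1 \<or> card (verts H) = card (verts G - X) + 1 \<Longrightarrow> has_double_cover r H"
  shows "has_double_cover r G"
proof -
  let ?Y = "verts G - X" and ?B = "edge_boundary G X"
  note wf = r_graphD(1)[OF G(1)]
  note bd = edge_boundary_Diff[OF wf, of X]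
  have "X \<noteq> {}" using X(2) by auto
  then have Y: "?Y \<subset> verts G" "odd (card ?Y)" "card (edge_boundary G ?Y) = r"
    using X bd odd_complement[OF G psubset_imp_subset[OF X(1)] X(2)] by auto
  have covX: "has_double_cover r H" if "r_graph r H" "card (verts H) = card X + 1"
    for H :: "(nat, nat) multigraph" using cov that by blast
  have covY: "has_double_cover r H" if "r_graph r H" "card (verts H) = card ?Y + 1"
    for H :: "(nat, nat) multigraph" using cov that by blast
  obtain N b where N: "\<And>i. i < 2 * r \<Longrightarrow> N i \<subseteq> incident_edges G X"
    "\<And>i v. i < 2 * r \<Longrightarrow> v \<in> X \<Longrightarrow> \<exists>!e. e \<in> N i \<and> v \<in> ends G e"
    "\<And>i. i < 2 * r \<Longrightarrow> N i \<inter> ?B = {b i}"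
    "\<And>e. e \<in> incident_edges G X \<Longrightarrow> card {i. i < 2 * r \<and> e \<in> N i} = 2"
    by (rule shore_double_cover[OF G X covX]) (assumption+, rule that)
  obtain L a where L: "\<And>i. i < 2 * r \<Longrightarrow> L i \<subseteq> incident_edges G ?Y"
    "\<And>i v. i < 2 * r \<Longrightarrow> v \<in> ?Y \<Longrightarrow> \<exists>!e. e \<in> L i \<and> v \<in> ends G e"
    "\<And>i. i < 2 * r \<Longrightarrow> L i \<inter> ?B = {a i}"
    "\<And>e. e \<in> incident_edges G ?Y \<Longrightarrow> card {i. i < 2 * r \<and> e \<in> L i} = 2"
    by (rule shore_double_cover[OF G Y covY, unfolded bd]) (assumption+, rule that)
  note inc = incident_Int_Diff[OF wf, of X]
  \<comment> \<open>Both fibres have two elements over a cut edge and none over anything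
    else.\<close>
  have fib: "card {i \<in> {..<2 * r}. b i = e} = card {i \<in> {..<2 * r}. a i = e}" for e
  proof (cases "e \<in> ?B")
    case True
    have single: "x = e \<longleftrightarrow> e \<in> Z" if "Z \<inter> ?B = {x}" for x Z
    proof -
      have "e \<in> Z \<longleftrightarrow> e \<in> Z \<inter> ?B" using True by simp
      then show ?thesis unfolding that by auto
    qed
    have "{i \<in> {..<2 * r}. b i = e} = {i. i < 2 * r \<and> e \<in> N i}"
      "{i \<in> {..<2 * r}. a i = e} = {i. i < 2 * r \<and> e \<in> L i}"
      using single[OF N(3)] single[OF L(3)] by auto
    moreover have "e \<in> incident_edges G X" "e \<in> incident_edges G ?Y" using True inc(1) by blast+
    ultimately show ?thesis using N(4)[of e] L(4)[of e] by simp
  next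
    case False
    have "b i \<noteq> e" "a i \<noteq> e" if "i < 2 * r" for i
      using N(3)[OF that] L(3)[OF that] False by (auto simp: set_eq_iff)
    then have "{i \<in> {..<2 * r}. b i = e} = {}" "{i \<in> {..<2 * r}. a i = e} = {}" by auto
    then show ?thesis by (simp only:)
  qed
  obtain s where s: "bij_betw s {..<2 * r} {..<2 * r}" "\<And>i. i < 2 * r \<Longrightarrow> a (s i) = b i"
    using align_equal_fibers[OF _ fib] by auto
  have s_less: "s i < 2 * r" if "i < 2 * r" for i using bij_betwE[OF s(1)] that by blast
  define M where "M i = N i \<union> L (s i)" for i
  \<comment> \<open>Sharing their one cut edge, \<open>N i\<close> and \<open>L (s i)\<close> add
    nothing to each other on the edges that both could contain. Hence the union restricts to
    \<open>N i\<close> on one side and to \<open>L (s i)\<close> on the other.\<close>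
  have bdry: "N i \<inter> ?B = L (s i) \<inter> ?B" if "i < 2 * r" for i
    using N(3)[OF that] L(3)[OF s_less[OF that]] s(2)[OF that] by simp
  have M_X: "e \<in> M i \<longleftrightarrow> e \<in> N i" if "i < 2 * r" "e \<in> incident_edges G X" for i e
    using that bdry[OF that(1)] L(1)[OF s_less[OF that(1)]] inc(1) unfolding M_def by blast
  have M_Y: "e \<in> M i \<longleftrightarrow> e \<in> L (s i)" if "i < 2 * r" "e \<in> incident_edges G ?Y" for i e
    using that bdry[OF that(1)] N(1)[OF that(1)] inc(1) unfolding M_def by blast
  have M_edges: "M i \<subseteq> edges G" if "i < 2 * r" for i
    using N(1)[OF that] L(1)[OF s_less[OF that]] unfolding M_def incident_edges_def by blast
  have pm: "perfect_matching G (M i)" if i: "i < 2 * r" for i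
    unfolding perfect_matching_def
  proof (intro conjI ballI)
    show "M i \<subseteq> edges G" using M_edges[OF i] .
    fix v assume v: "v \<in> verts G"
    show "\<exists>!e. e \<in> M i \<and> v \<in> ends G e"
    proof (cases "v \<in> X")
      case True
      have "e \<in> M i \<and> v \<in> ends G e \<longleftrightarrow> e \<in> N i \<and> v \<in> ends G e" for e
        using M_X[OF i, of e] M_edges[OF i] N(1)[OF i] True unfolding incident_edges_def by blast
      then show ?thesis using N(2)[OF i True] by simp
    next
      case False
      then have vY: "v \<in> ?Y" using v by blast
      have "e \<in> M i \<and> v \<in> ends G e \<longleftrightarrow> e \<in> L (s i) \<and> v \<in> ends G e" for e
        using M_Y[OF i, of e] M_edges[OF i] L(1)[OF s_less[OF i]] vY unfolding incident_edges_def by blast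
      then show ?thesis using L(2)[OF s_less[OF i] vY] by simp
    qed
  qed
  have two: "card {i. i < 2 * r \<and> e \<in> M i} = 2" if e: "e \<in> edges G" for e
  proof (cases "e \<in> incident_edges G X")
    case True
    have "{i. i < 2 * r \<and> e \<in> M i} = {i. i < 2 * r \<and> e \<in> N i}" using M_X[OF _ True] by auto
    then show ?thesis using N(4)[OF True] by simp
  next
    case False
    then have eY: "e \<in> incident_edges G ?Y" using inc(2) e by blast
    have inj: "inj_on s {..<2 * r}" and surj: "s ` {..<2 * r} = {..<2 * r}"
      using s(1) unfolding bij_betw_def by auto
    \<comment> \<open>On the second shore the positions are renumbered by \<open>s\<close>; as a
      permutation it preserves the count of two.\<close>
    have "s ` {i. i < 2 * r \<and> e \<in> M i} = {i. i < 2 * r \<and> e \<in> L i}"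
    proof
      show "s ` {i. i < 2 * r \<and> e \<in> M i} \<subseteq> {i. i < 2 * r \<and> e \<in> L i}"
        using M_Y[OF _ eY] s_less by blast
      show "{i. i < 2 * r \<and> e \<in> L i} \<subseteq> s ` {i. i < 2 * r \<and> e \<in> M i}"
      proof
        fix j assume j: "j \<in> {i. i < 2 * r \<and> e \<in> L i}"
        then obtain i where "i < 2 * r" "j = s i" using surj by (auto simp: image_def set_eq_iff)
        then show "j \<in> s ` {i. i < 2 * r \<and> e \<in> M i}" using j M_Y[OF _ eY] by blast
      qed
    qed
    moreover have "inj_on s {i. i < 2 * r \<and> e \<in> M i}" by (rule inj_on_subset[OF inj]) auto
    ultimately have "card {i. i < 2 * r \<and> e \<in> M i} = card {i. i < 2 * r \<and> e \<in> L i}"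
      using card_image by fastforce
    then show ?thesis using L(4)[OF eY] by simp
  qed
  define Ms where "Ms = map M [0..<2 * r]"
  have "length Ms = 2 * r" "\<forall>A\<in>set Ms. perfect_matching G A"
    using pm unfolding Ms_def by auto
  moreover have "card {i. i < length Ms \<and> e \<in> Ms ! i} = 2" if "e \<in> edges G" for e
  proof -
    have "{i. i < length Ms \<and> e \<in> Ms ! i} = {i. i < 2 * r \<and> e \<in> M i}" unfolding Ms_def by auto
    then show ?thesis using two[OF that] by simp
  qed
  ultimately show ?thesis unfolding has_double_cover_def by blast
qed

section \<open>Regular bipartite graphs\<close>

lemma incident_edges_UN: "incident_edges G S = (\<Union>v\<in>S. {e \<in> edges G. v \<in> ends G e})"
  unfolding incident_edges_def by blast

lemma card_incident_edges_le:
  assumes "wf_multigraph G" "regular_graph r G" "S \<subseteq> verts G"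
  shows "card (incident_edges G S) \<le> r * card S"
proof -
  have "finite S" using assms finite_subset unfolding wf_multigraph_def by metis
  then have "card (incident_edges G S) \<le> (\<Sum>v\<in>S. card {e \<in> edges G. v \<in> ends G e})"
    unfolding incident_edges_UN by (rule card_UN_le)
  also have "\<dots> = (\<Sum>v\<in>S. r)"
    using assms(2,3) by (intro sum.cong) (auto simp: regular_graph_def vertex_degree_def)
  finally show ?thesis by (simp add: mult.commute)
qed

lemma card_incident_edges_independent:
  assumes "wf_multigraph G" "regular_graph r G" "S \<subseteq> verts G"
    and "\<And>e. e \<in> edges G \<Longrightarrow> card (ends G e \<inter> S) \<le> 1"
  shows "card (incident_edges G S) = r * card S"
proof -
  have fin: "finite (edges G)" and "finite S"
    using assms finite_subset unfolding wf_multigraph_def by metis+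
  have "x = y" if "x \<in> S" "y \<in> S" "e \<in> edges G" "x \<in> ends G e" "y \<in> ends G e" for x y e
  proof -
    have "finite (ends G e)" using assms(1) that(3) unfolding wf_multigraph_def by (metis finite_subset)
    then show ?thesis using assms(4)[OF that(3)] that card_le_Suc0_iff_eq[of "ends G e \<inter> S"] by simp
  qed
  then have "\<forall>x\<in>S. \<forall>y\<in>S. x \<noteq> y \<longrightarrow> {e \<in> edges G. x \<in> ends G e} \<inter> {e \<in> edges G. y \<in> ends G e} = {}"
    by auto
  then have "card (incident_edges G S) = (\<Sum>v\<in>S. card {e \<in> edges G. v \<in> ends G e})"
    unfolding incident_edges_UN using fin \<open>finite S\<close> by (intro card_UN_disjoint) auto
  also have "\<dots> = (\<Sum>v\<in>S. r)"
    using assms(2,3) by (intro sum.cong) (auto simp: regular_graph_def vertex_degree_def)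
  finally show ?thesis by (simp add: mult.commute)
qed

text \<open>Choose one edge from each class of parallel edges; disjointness of the pairs gives
  uniqueness at every vertex.\<close>

lemma perfect_matching_of_set_matching:
  assumes "set_matching (ends H ` edges H) (verts H) M"
  obtains N where "perfect_matching H N"
proof -
  have M: "M \<subseteq> ends H ` edges H" "\<Union>M = verts H" "pairwise disjnt M"
    using assms unfolding set_matching_def by blast+
  define g where "g = inv_into (edges H) (ends H)"
  have g: "g m \<in> edges H" "ends H (g m) = m" if "m \<in> M" for m
    using M(1) that inv_into_into[of m "ends H" "edges H"] f_inv_into_f[of m "ends H" "edges H"]
    unfolding g_def by auto
  have "perfect_matching H (g ` M)"
    unfolding perfect_matching_def
  proof (intro conjI ballI)
    show "g ` M \<subseteq> edges H" using g(1) by auto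
    fix v assume "v \<in> verts H"
    then obtain m where m: "m \<in> M" "v \<in> m" using M(2) by blast
    show "\<exists>!e. e \<in> g ` M \<and> v \<in> ends H e"
    proof (rule ex1I[of _ "g m"])
      show "g m \<in> g ` M \<and> v \<in> ends H (g m)" using m g(2) by simp
      fix e assume e: "e \<in> g ` M \<and> v \<in> ends H e"
      then obtain n where n: "n \<in> M" "e = g n" by blast
      then have "v \<in> n" using e g(2) by simp
      then have "n = m" using M(3) m n(1) unfolding pairwise_def disjnt_def by blast
      then show "e = g m" using n(2) by simp
    qed
  qed
  then show thesis by (rule that)
qed

text \<open>Hall's condition follows by counting edges between a set and its neighbourhood, using
  regularity on both sides.\<close>

lemma bipartite_regular_perfect_matching:
  assumes wf: "wf_multigraph G" and reg: "regular_graph r G" and "r \<ge> 1" and "bipartite G"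
  obtains M where "perfect_matching G M"
proof -
  obtain A B where AB: "A \<union> B = verts G" "A \<inter> B = {}"
    "\<And>e. e \<in> edges G \<Longrightarrow> \<exists>a\<in>A. \<exists>b\<in>B. ends G e = {a, b}"
    using assms(4) unfolding bipartite_def by metis
  have fin: "finite A" "finite B" "finite (edges G)"
    using wf AB(1) unfolding wf_multigraph_def by (metis finite_Un)+
  have sub: "A \<subseteq> verts G" "B \<subseteq> verts G" using AB(1) by blast+
  have indA: "card (ends G e \<inter> J) \<le> 1" if e: "e \<in> edges G" and J: "J \<subseteq> A \<or> J \<subseteq> B" for e J
  proof -
    obtain a b where ab: "a \<in> A" "b \<in> B" "ends G e = {a, b}" using AB(3)[OF e] by blast
    have "a \<notin> J \<or> b \<notin> J" using J AB(2) ab(1,2) by blast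
    then have "ends G e \<inter> J \<subseteq> {a} \<or> ends G e \<inter> J \<subseteq> {b}" unfolding ab(3) by auto
    then show ?thesis
      using card_mono[of "{a}" "ends G e \<inter> J"] card_mono[of "{b}" "ends G e \<inter> J"] by auto
  qed
  \<comment> \<open>Every edge has one end in each class, so both classes count all edges once; this
    yields equal class sizes.\<close>
  have meets: "incident_edges G A = edges G" "incident_edges G B = edges G"
  proof -
    have "ends G e \<inter> A \<noteq> {} \<and> ends G e \<inter> B \<noteq> {}" if e: "e \<in> edges G" for e
    proof -
      obtain a b where "a \<in> A" "b \<in> B" "ends G e = {a, b}" using AB(3)[OF e] by blast
      then show ?thesis by blast
    qed
    then show "incident_edges G A = edges G" "incident_edges G B = edges G"
      unfolding incident_edges_def by blast+
  qed
  have "r * card A = r * card B"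
    using card_incident_edges_independent[OF wf reg sub(1) indA]
      card_incident_edges_independent[OF wf reg sub(2) indA] unfolding meets by auto
  then have cardAB: "card A = card B" using assms(3) by simp
  define N where "N a = {b \<in> B. \<exists>e\<in>edges G. ends G e = {a, b}}" for a
  have "\<exists>f. inj_on f A \<and> (\<forall>a\<in>A. f a \<in> N a)"
  proof (rule hall_marriage)
    show "finite A" by fact
    show "finite (N a)" for a using fin unfolding N_def by simp
    fix J assume J: "J \<subseteq> A"
    have JV: "J \<subseteq> verts G" and NV: "\<Union>(N ` J) \<subseteq> verts G" using J sub unfolding N_def by auto
    \<comment> \<open>The \<open>r * card J\<close> edges at \<open>J\<close> all end in its
      neighbourhood, which accommodates at most \<open>r\<close> edges per vertex.\<close>
    have "incident_edges G J \<subseteq> incident_edges G (\<Union>(N ` J))"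
    proof
      fix e assume "e \<in> incident_edges G J"
      then have e: "e \<in> edges G" "ends G e \<inter> J \<noteq> {}" unfolding incident_edges_def by auto
      obtain a b where ab: "a \<in> A" "b \<in> B" "ends G e = {a, b}" using AB(3)[OF e(1)] by blast
      have "b \<notin> J" using ab(2) J AB(2) by blast
      then have "a \<in> J" using e(2) ab(3) by auto
      moreover have "b \<in> N a" using ab e(1) unfolding N_def by blast
      ultimately show "e \<in> incident_edges G (\<Union>(N ` J))"
        using e(1) ab(3) unfolding incident_edges_def by auto
    qed
    then have "card (incident_edges G J) \<le> card (incident_edges G (\<Union>(N ` J)))"
      using fin(3) by (intro card_mono) (auto simp: incident_edges_def)
    also have "\<dots> \<le> r * card (\<Union>(N ` J))" by (rule card_incident_edges_le[OF wf reg NV])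
    also have "card (incident_edges G J) = r * card J"
      using indA J by (intro card_incident_edges_independent[OF wf reg JV]) blast
    finally show "card J \<le> card (\<Union>(N ` J))" using assms(3) by simp
  qed
  then obtain f where f: "inj_on f A" "\<And>a. a \<in> A \<Longrightarrow> f a \<in> N a" by auto
  have fB: "f ` A \<subseteq> B" using f(2) unfolding N_def by auto
  then have fA: "f ` A = B"
    using cardAB f(1) fin(2) by (intro card_subset_eq) (auto simp: card_image)
  have "set_matching (ends G ` edges G) (verts G) ((\<lambda>a. {a, f a}) ` A)"
    unfolding set_matching_def
  proof (intro conjI)
    show "(\<lambda>a. {a, f a}) ` A \<subseteq> ends G ` edges G"
    proof
      fix m assume "m \<in> (\<lambda>a. {a, f a}) ` A"
      then obtain a where a: "a \<in> A" "m = {a, f a}" by blast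
      obtain e where "e \<in> edges G" "ends G e = {a, f a}" using f(2)[OF a(1)] unfolding N_def by blast
      then show "m \<in> ends G ` edges G" using a(2) by (metis imageI)
    qed
    have "\<Union>((\<lambda>a. {a, f a}) ` A) = A \<union> f ` A" by auto
    then show "\<Union>((\<lambda>a. {a, f a}) ` A) = verts G" using fA AB(1) by simp
    show "pairwise disjnt ((\<lambda>a. {a, f a}) ` A)"
    proof (rule pairwiseI)
      fix m n assume "m \<in> (\<lambda>a. {a, f a}) ` A" "n \<in> (\<lambda>a. {a, f a}) ` A" and ne: "m \<noteq> n"
      then obtain a b where ab: "a \<in> A" "m = {a, f a}" "b \<in> A" "n = {b, f b}" by blast
      have "a \<noteq> b" using ab ne by blast
      moreover have "f a \<noteq> f b" using \<open>a \<noteq> b\<close> f(1) ab unfolding inj_on_def by blast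
      moreover have "f a \<in> B" "f b \<in> B" using fB ab by blast+
      ultimately show "disjnt m n" using ab AB(2) unfolding disjnt_def by auto
    qed
  qed
  then show thesis by (rule perfect_matching_of_set_matching) (rule that)
qed

text \<open>Peel off one perfect matching as the last color class. Its removal may disconnect the
  graph, so the induction runs over regular bipartite graphs rather than over r-graphs.\<close>

theorem bipartite_regular_edge_colorable:
  assumes "wf_multigraph G" "regular_graph r G" "bipartite G"
  shows "edge_colorable r G"
  using assms
proof (induction r arbitrary: G)
  case 0
  have "edges G = {}"
  proof (rule ccontr)
    assume "edges G \<noteq> {}"
    then obtain e where e: "e \<in> edges G" by blast
    obtain a b where ab: "ends G e = {a, b}" "a \<in> verts G" using edge_endsE[OF "0.prems"(1) e] by metis
    have "finite {e \<in> edges G. a \<in> ends G e}" using "0.prems"(1) unfolding wf_multigraph_def by simp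
    moreover have "card {e \<in> edges G. a \<in> ends G e} = 0"
      using "0.prems"(2) ab(2) unfolding regular_graph_def vertex_degree_def by blast
    ultimately show False using e ab(1) by auto
  qed
  then show ?case unfolding edge_colorable_def by simp
next
  case (Suc r)
  note wf = Suc.prems(1)
  obtain M where M: "perfect_matching G M"
    using bipartite_regular_perfect_matching[OF Suc.prems(1,2) _ Suc.prems(3)] by auto
  have ME: "M \<subseteq> edges G" and M1: "\<And>v. v \<in> verts G \<Longrightarrow> \<exists>!e. e \<in> M \<and> v \<in> ends G e"
    using M unfolding perfect_matching_def by blast+
  define H where "H = G\<lparr>edges := edges G - M\<rparr>"
  have H: "verts H = verts G" "edges H = edges G - M" "ends H = ends G" unfolding H_def by simp_all
  have wfH: "wf_multigraph H" using wf unfolding wf_multigraph_def H by simp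
  have "vertex_degree H v = r" if v: "v \<in> verts G" for v
  proof -
    obtain e where e: "e \<in> M" "v \<in> ends G e" and uniq: "\<And>f. f \<in> M \<Longrightarrow> v \<in> ends G f \<Longrightarrow> f = e"
      using M1[OF v] by auto
    have "{f \<in> edges H. v \<in> ends H f} = {f \<in> edges G. v \<in> ends G f} - {e}"
      unfolding H using e uniq by blast
    moreover have "card {f \<in> edges G. v \<in> ends G f} = Suc r"
      using Suc.prems(2) v unfolding regular_graph_def vertex_degree_def by blast
    moreover have "e \<in> {f \<in> edges G. v \<in> ends G f}" using e ME by blast
    ultimately show ?thesis unfolding vertex_degree_def by (simp add: card_Diff_singleton)
  qed
  then have regH: "regular_graph r H" unfolding regular_graph_def H by blast
  have bipH: "bipartite H" using Suc.prems(3) unfolding bipartite_def H by (metis DiffD1)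
  obtain c where c: "c ` edges H \<subseteq> {..<r}" "\<forall>v\<in>verts H. inj_on c {e \<in> edges H. v \<in> ends H e}"
    using Suc.IH[OF wfH regH bipH] unfolding edge_colorable_iff[OF wfH] by (elim exE conjE)
  define d where "d e = (if e \<in> M then r else c e)" for e
  have less: "c e < r" if "e \<in> edges G" "e \<notin> M" for e using c(1) that unfolding H by auto
  have "d ` edges G \<subseteq> {..<Suc r}" using less unfolding d_def by (auto simp: less_SucI)
  moreover have "inj_on d {e \<in> edges G. v \<in> ends G e}" if v: "v \<in> verts G" for v
  proof (rule inj_onI)
    fix e f assume ef: "e \<in> {e \<in> edges G. v \<in> ends G e}" "f \<in> {e \<in> edges G. v \<in> ends G e}" "d e = d f"
    show "e = f"
    proof (cases "e \<in> M")
      case True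
      then have "f \<in> M" using ef less[of f] unfolding d_def by (cases "f \<in> M") auto
      then show ?thesis using True M1[OF v] ef(1,2) by auto
    next
      case False
      then have "f \<notin> M" using ef less[of e] unfolding d_def by (cases "f \<in> M") auto
      then show ?thesis using False c(2) v ef unfolding H d_def inj_on_def by simp
    qed
  qed
  ultimately show ?case unfolding edge_colorable_iff[OF wf] by (intro exI[of _ d] conjI ballI)
qed

text \<open>With \<open>r\<close> colors and \<open>r\<close> edges at each vertex every color
  occurs at every vertex, so color classes are perfect matchings; each is taken twice.\<close>

lemma regular_edge_colorable_double_cover:
  assumes wf: "wf_multigraph G" and reg: "regular_graph r G" and col: "edge_colorable r G"
  shows "has_double_cover r G"
proof -
  obtain c where c: "c ` edges G \<subseteq> {..<r}" "\<forall>v\<in>verts G. inj_on c {e \<in> edges G. v \<in> ends G e}"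
    using col unfolding edge_colorable_iff[OF wf] by (elim exE conjE)
  define M where "M j = {e \<in> edges G. c e = j}" for j
  have pm: "perfect_matching G (M j)" if j: "j < r" for j
    unfolding perfect_matching_def
  proof (intro conjI ballI)
    show "M j \<subseteq> edges G" unfolding M_def by blast
    fix v assume v: "v \<in> verts G"
    let ?E = "{e \<in> edges G. v \<in> ends G e}"
    have inj: "inj_on c ?E" using c(2) v by blast
    have "card ?E = r" using reg v unfolding regular_graph_def vertex_degree_def by blast
    moreover have "c ` ?E \<subseteq> {..<r}" using c(1) by blast
    ultimately have "c ` ?E = {..<r}" using inj by (intro card_subset_eq) (auto simp: card_image)
    then have "j \<in> c ` ?E" using j by simp
    then obtain e where e: "e \<in> ?E" "c e = j" by blast
    show "\<exists>!e. e \<in> M j \<and> v \<in> ends G e"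
    proof (rule ex1I[of _ e])
      show "e \<in> M j \<and> v \<in> ends G e" using e unfolding M_def by simp
      fix f assume f: "f \<in> M j \<and> v \<in> ends G f"
      show "f = e" by (rule inj_onD[OF inj]) (use f e in \<open>auto simp: M_def\<close>)
    qed
  qed
  \<comment> \<open>Halving the index puts the class of color \<open>j\<close> at positions
    \<open>2 * j\<close> and \<open>2 * j + 1\<close>.\<close>
  define Ms where "Ms = map (\<lambda>i. M (i div 2)) [0..<2 * r]"
  have "length Ms = 2 * r" unfolding Ms_def by simp
  moreover have "\<forall>A\<in>set Ms. perfect_matching G A"
    using pm unfolding Ms_def by auto
  moreover have "card {i. i < length Ms \<and> e \<in> Ms ! i} = 2" if e: "e \<in> edges G" for e
  proof -
    have "c e < r" using c(1) e by blast
    then have "{i. i < length Ms \<and> e \<in> Ms ! i} = {2 * c e, 2 * c e + 1}"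
      using e unfolding Ms_def M_def by auto
    then show ?thesis by simp
  qed
  ultimately show ?thesis unfolding has_double_cover_def by blast
qed

section \<open>Barriers and vertex cuts\<close>

lemma connected_edge_boundary:
  assumes "wf_multigraph G" "graph_connected G" "X \<subset> verts G" "X \<noteq> {}"
  shows "edge_boundary G X \<noteq> {}"
proof
  assume empty: "edge_boundary G X = {}"
  obtain x y where xy: "x \<in> X" "y \<in> verts G" "y \<notin> X" using assms(3,4) by blast
  have step: "v \<in> X" if uv: "(u, v) \<in> adjacency G" and u: "u \<in> X" for u v
  proof (rule ccontr)
    assume v: "v \<notin> X"
    obtain e where e: "e \<in> edges G" "ends G e = {u, v}" using uv unfolding adjacency_def by blast
    then have "e \<in> edge_boundary G X" using edge_boundary_iff[OF e, of X] u v by blast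
    then show False using empty by blast
  qed
  have "(x, y) \<in> (adjacency G)\<^sup>*" using assms(2,3) xy unfolding graph_connected_def by blast
  then have "y \<in> X" by induction (use xy(1) step in auto)
  then show False using xy(3) by blast
qed

text \<open>At least \<open>r\<close> edges leave each member of \<open>F\<close>, all of them go to
  \<open>S\<close>, and at most \<open>r * card S\<close> edges meet \<open>S\<close>. So equality
  holds throughout: members span tight cuts, and every edge at \<open>S\<close> enters a member,
  which makes \<open>S\<close> independent. Connectedness excludes further vertices.\<close>

lemma barrier_bipartite:
  assumes G: "r_graph r G" and fam: "odd_family (ends G ` edges G) (verts G) S F"
    and card: "card S \<le> card F" "2 \<le> card S" and "r \<ge> 1"
    and tight: "\<And>X. X \<subseteq> verts G \<Longrightarrow> odd (card X) \<Longrightarrow> card (edge_boundary G X) = r \<Longrightarrow>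
      card X = 1 \<or> card (verts G - X) = 1"
  shows "bipartite G"
proof -
  note wf = r_graphD(1)[OF G] and fin = r_graphD(2,3)[OF G]
  note finF = odd_family_finite[OF fam fin(1)]
  have F: "S \<subseteq> verts G" "pairwise disjnt F" "\<And>A. A \<in> F \<Longrightarrow> A \<subseteq> verts G - S" "\<And>A. A \<in> F \<Longrightarrow> odd (card A)"
    and edge0: "\<And>A e. A \<in> F \<Longrightarrow> e \<in> ends G ` edges G \<Longrightarrow> e \<subseteq> verts G \<Longrightarrow> e \<inter> A \<noteq> {} \<Longrightarrow> e \<subseteq> A \<union> S"
    using fam unfolding odd_family_def by blast+
  have edge: "ends G e \<subseteq> A \<union> S" if "A \<in> F" "e \<in> edges G" "ends G e \<inter> A \<noteq> {}" for A e
    using edge0[OF that(1) imageI[OF that(2)] _ that(3)] wf that(2) unfolding wf_multigraph_def by blast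
  have FV: "A \<subseteq> verts G" if "A \<in> F" for A using F(3)[OF that] by blast
  have bd: "e \<in> edges G" "ends G e \<inter> A \<noteq> {}" "ends G e \<inter> S \<noteq> {}"
    if "A \<in> F" "e \<in> edge_boundary G A" for A e
  proof -
    show e: "e \<in> edges G" using that(2) by (rule edge_boundary_edge)
    obtain a b where ab: "ends G e = {a, b}" "a \<noteq> b" using edge_endsE[OF wf e] by metis
    then show "ends G e \<inter> A \<noteq> {}" using that(2) edge_boundary_iff[OF e ab, of A] by auto
    then have "ends G e \<subseteq> A \<union> S" using edge that(1) e by blast
    then show "ends G e \<inter> S \<noteq> {}" using that(2) edge_boundary_iff[OF e ab, of A] ab by auto
  qed
  have disj: "edge_boundary G A \<inter> edge_boundary G B = {}" if AB: "A \<in> F" "B \<in> F" "A \<noteq> B" for A B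
  proof (rule ccontr)
    assume "edge_boundary G A \<inter> edge_boundary G B \<noteq> {}"
    then obtain e where e: "e \<in> edge_boundary G A" "e \<in> edge_boundary G B" by blast
    have "ends G e \<subseteq> A \<union> S" using edge[OF AB(1) bd(1,2)[OF AB(1) e(1)]] .
    moreover have "ends G e \<inter> B \<noteq> {}" using bd(2)[OF AB(2) e(2)] .
    moreover have "A \<inter> B = {}" using F(2) AB unfolding pairwise_def disjnt_def by blast
    ultimately show False using F(3)[OF AB(2)] by blast
  qed
  let ?U = "\<Union>A\<in>F. edge_boundary G A"
  have finb: "finite (edge_boundary G A)" for A using finite_subset[OF edge_boundary_subset fin(2)] .
  have U: "?U \<subseteq> incident_edges G S" using bd(1,3) unfolding incident_edges_def by auto
  have reg: "regular_graph r G" using G unfolding r_graph_def by blast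
  have fini: "finite (incident_edges G S)" using fin(2) unfolding incident_edges_def by simp
  have ge: "r \<le> card (edge_boundary G A)" if "A \<in> F" for A
    using r_graphD(6)[OF G FV[OF that] F(4)[OF that]] .
  have "(\<Sum>A\<in>F. r) \<le> (\<Sum>A\<in>F. card (edge_boundary G A))" using ge by (rule sum_mono)
  moreover have sumU: "(\<Sum>A\<in>F. card (edge_boundary G A)) = card ?U"
    using finF(1) finb disj by (intro card_UN_disjoint[symmetric]) auto
  moreover have "card ?U \<le> card (incident_edges G S)" using card_mono[OF fini U] .
  moreover have "card (incident_edges G S) \<le> r * card S" using card_incident_edges_le[OF wf reg F(1)] .
  moreover have "r * card S \<le> (\<Sum>A\<in>F. r)" using card(1) by (simp add: mult.commute)
  ultimately have eq: "(\<Sum>A\<in>F. r) = (\<Sum>A\<in>F. card (edge_boundary G A))" "card ?U = card (incident_edges G S)"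
    by linarith+
  \<comment> \<open>No edge has both ends in \<open>S\<close> or leads from \<open>S\<close> to a
    vertex outside the family.\<close>
  have Ueq: "?U = incident_edges G S" using card_subset_eq[OF fini U eq(2)] .
  have single: "card A = 1" if A: "A \<in> F" for A
  proof -
    have "card (edge_boundary G A) = r"
      using sum_mono_inv[OF eq(1) ge A finF(1)] by simp
    then have "card A = 1 \<or> card (verts G - A) = 1" using tight FV[OF A] F(4)[OF A] by blast
    \<comment> \<open>Here \<open>2 \<le> card S\<close> is what rules out a singleton
      complement.\<close>
    moreover have "card (verts G - A) \<ge> 2"
    proof -
      have "S \<subseteq> verts G - A" using F(1) F(3)[OF A] by blast
      then have "card S \<le> card (verts G - A)" using fin(1) by (intro card_mono) auto
      then show ?thesis using card(2) by simp
    qed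
    ultimately show ?thesis by simp
  qed
  have S_edge: "\<exists>A\<in>F. e \<in> edge_boundary G A" if "e \<in> edges G" "ends G e \<inter> S \<noteq> {}" for e
    using that Ueq unfolding incident_edges_def by blast
  \<comment> \<open>No edge leaves \<open>S \<union> \<Union>F\<close>: one meeting \<open>S\<close>
    enters a member, and one meeting a member \<open>A\<close> stays inside
    \<open>A \<union> S\<close>.\<close>
  have "verts G = S \<union> \<Union>F"
  proof (rule ccontr)
    assume "verts G \<noteq> S \<union> \<Union>F"
    then have "S \<union> \<Union>F \<subset> verts G" using F(1) FV by blast
    moreover have "S \<union> \<Union>F \<noteq> {}" using card(2) by auto
    ultimately obtain e where e: "e \<in> edge_boundary G (S \<union> \<Union>F)"
      using connected_edge_boundary[OF wf r_graphD(4)[OF G]] by blast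
    then have eE: "e \<in> edges G" by (rule edge_boundary_edge)
    obtain a b where ab: "ends G e = {a, b}" "a \<noteq> b" using edge_endsE[OF wf eE] by metis
    have "\<exists>A\<in>F. ends G e \<inter> A \<noteq> {}"
    proof (cases "ends G e \<inter> S = {}")
      case True
      then have "ends G e \<inter> \<Union>F \<noteq> {}" using e edge_boundary_iff[OF eE ab, of "S \<union> \<Union>F"] ab(1) by auto
      then show ?thesis by blast
    next
      case False
      then obtain A where "A \<in> F" "e \<in> edge_boundary G A" using S_edge[OF eE] by blast
      then show ?thesis using bd(2) by blast
    qed
    then obtain A where A: "A \<in> F" "ends G e \<inter> A \<noteq> {}" by blast
    have "ends G e \<subseteq> S \<union> \<Union>F" using edge[OF A(1) eE A(2)] A(1) by blast
    then show False using e edge_boundary_iff[OF eE ab, of "S \<union> \<Union>F"] ab(1) by auto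
  qed
  moreover have "S \<inter> \<Union>F = {}" using F(3) by blast
  moreover have "\<exists>a\<in>S. \<exists>b\<in>\<Union>F. ends G e = {a, b}" if e: "e \<in> edges G" for e
  proof -
    obtain a b where ab: "ends G e = {a, b}" "a \<noteq> b" "a \<in> verts G" using edge_endsE[OF wf e] by metis
    have "\<exists>A\<in>F. ends G e \<inter> A \<noteq> {}"
    proof (cases "ends G e \<inter> S = {}")
      case True
      then have "a \<in> \<Union>F" using ab \<open>verts G = S \<union> \<Union>F\<close> by auto
      then show ?thesis using ab(1) by blast
    next
      case False
      then obtain A where "A \<in> F" "e \<in> edge_boundary G A" using S_edge[OF e] by blast
      then show ?thesis using bd(2) by blast
    qed
    then obtain A where A: "A \<in> F" "ends G e \<inter> A \<noteq> {}" by blast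
    have sub: "ends G e \<subseteq> A \<union> S" using edge[OF A(1) e A(2)] .
    obtain z where z: "A = {z}" using single[OF A(1)] card_1_singletonE by metis
    have "z \<in> {a, b}" "a \<in> {z} \<union> S" "b \<in> {z} \<union> S" using A(2) sub ab(1) z by auto
    then obtain s where s: "s \<in> S" "{a, b} = {s, z}" using ab(2) by auto
    have "z \<in> \<Union>F" using A(1) z by auto
    then have "\<exists>b\<in>\<Union>F. ends G e = {s, b}" using ab(1) s(2) by (intro bexI[of _ z]) simp_all
    then show ?thesis using s(1) by (rule bexI)
  qed
  ultimately show ?thesis unfolding bipartite_def by (intro exI[of _ S] exI[of _ "\<Union>F"]) simp
qed

text \<open>A family violating Tutte's condition in G - u - v, once completed by parity, has at
  least \<open>card S + 2\<close> members. It is also a family for \<open>S \<union> {u, v}\<close>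
  in \<open>G\<close>, since an edge from a member to \<open>u\<close> or \<open>v\<close> now ends
  in the enlarged set.\<close>

lemma bicritical_if_tight_cuts_trivial:
  assumes G: "r_graph r G" "r \<ge> 1" and nb: "\<not> bipartite G"
    and tight: "\<And>X. X \<subseteq> verts G \<Longrightarrow> odd (card X) \<Longrightarrow> card (edge_boundary G X) = r \<Longrightarrow>
      card X = 1 \<or> card (verts G - X) = 1"
  shows "bicritical G"
  unfolding bicritical_def
proof (intro ballI impI, rule ccontr)
  fix u v assume uv: "u \<in> verts G" "v \<in> verts G" "u \<noteq> v"
    and none: "\<nexists>M. perfect_matching (del_verts G {u, v}) M"
  note wf = r_graphD(1)[OF G(1)] and fin = r_graphD(2)[OF G(1)]
  let ?H = "del_verts G {u, v}"
  let ?E = "ends ?H ` edges ?H" and ?V = "verts ?H"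
  have H: "?V = verts G - {u, v}" "ends ?H = ends G" "edges ?H = {e \<in> edges G. ends G e \<inter> {u, v} = {}}"
    unfolding del_verts_def by simp_all
  have finV: "finite ?V" unfolding H using fin by simp
  have E2: "card e = 2" if "e \<in> ?E" for e using that wf unfolding H wf_multigraph_def by auto
  have evV: "even (card ?V)"
  proof -
    have "card (verts G) = card ?V + card {u, v}"
      unfolding H using uv fin by (metis card_Diff_subset card_mono empty_subsetI finite.emptyI finite_insert insert_subset le_add_diff_inverse2)
    then show ?thesis using even_card_verts[OF G] uv(3) by simp
  qed
  have "\<nexists>M. set_matching ?E ?V M"
    using none perfect_matching_of_set_matching[of ?H] by blast
  then obtain S F where SF: "odd_family ?E ?V S F" "\<not> card F \<le> card S"
    using tutte[OF finV E2] by blast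
  obtain F' where F': "odd_family ?E ?V S F'" "F \<subseteq> F'" "even (card F' + card S + card ?V)"
    using odd_family_parity[OF SF(1) finV E2] by blast
  have "card F \<le> card F'" using card_mono[OF odd_family_finite(1)[OF F'(1) finV] F'(2)] .
  then have big: "card S + 2 \<le> card F'" using SF(2) F'(3) evV by presburger
  have fam: "odd_family (ends G ` edges G) (verts G) (S \<union> {u, v}) F'"
    unfolding odd_family_def
  proof (intro conjI ballI impI)
    show "S \<union> {u, v} \<subseteq> verts G" using F'(1) uv unfolding odd_family_def H by blast
    show "pairwise disjnt F'" using F'(1) unfolding odd_family_def by blast
    fix A assume A: "A \<in> F'"
    have A': "A \<subseteq> verts G - {u, v} - S" "odd (card A)"
      using F'(1) A unfolding odd_family_def H by blast+
    show "A \<subseteq> verts G - (S \<union> {u, v})" "odd (card A)" using A' by blast+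
    fix x assume x: "x \<in> ends G ` edges G" "x \<subseteq> verts G \<and> x \<inter> A \<noteq> {}"
    then obtain e where e: "e \<in> edges G" "x = ends G e" by blast
    obtain a b where ab: "ends G e = {a, b}" using edge_endsE[OF wf e(1)] by metis
    show "x \<subseteq> A \<union> (S \<union> {u, v})"
    proof (cases "ends G e \<inter> {u, v} = {}")
      case True
      then have "x \<in> ?E" "x \<subseteq> ?V" using e x(2) unfolding H by blast+
      then have "x \<subseteq> A \<union> S" using F'(1) A x(2) unfolding odd_family_def by blast
      then show ?thesis by blast
    next
      case False
      then show ?thesis using x(2) e(2) ab A'(1) by auto
    qed
  qed
  have card: "card (S \<union> {u, v}) = card S + 2"
  proof -
    have "S \<inter> {u, v} = {}" using F'(1) unfolding odd_family_def H by blast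
    then show ?thesis using odd_family_finite(2)[OF F'(1) finV] uv(3) by (simp add: card_Un_disjoint)
  qed
  have "bipartite G"
    by (rule barrier_bipartite[OF G(1) fam _ _ G(2) tight]) (use card big in simp_all)
  then show False using nb by blast
qed

section \<open>Vertex cuts of size at most two\<close>

text \<open>\<open>A\<close> is one component of G - X and \<open>B\<close> is everything else,
  possibly several components.\<close>

lemma disconnected_split:
  assumes "wf_multigraph G" "\<not> graph_connected (del_verts G X)" "verts G - X \<noteq> {}"
  obtains A B where "A \<union> B = verts G - X" "A \<inter> B = {}" "A \<noteq> {}" "B \<noteq> {}"
    "\<And>e. e \<in> edges G \<Longrightarrow> ends G e \<inter> A = {} \<or> ends G e \<inter> B = {}"
proof -
  let ?R = "(adjacency (del_verts G X))\<^sup>*"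
  obtain a b where ab: "a \<in> verts G - X" "b \<in> verts G - X" "(a, b) \<notin> ?R"
    using assms(2,3) unfolding graph_connected_def by (auto simp: del_verts_def)
  define A where "A = {z \<in> verts G - X. (a, z) \<in> ?R}"
  define B where "B = verts G - X - A"
  show thesis
  proof (rule that)
    show "A \<union> B = verts G - X" "A \<inter> B = {}" unfolding A_def B_def by blast+
    show "A \<noteq> {}" "B \<noteq> {}" using ab unfolding A_def B_def by blast+
    fix e assume e: "e \<in> edges G"
    show "ends G e \<inter> A = {} \<or> ends G e \<inter> B = {}"
    proof (rule ccontr)
      assume "\<not> ?thesis"
      then obtain x y where xy: "x \<in> ends G e" "x \<in> A" "y \<in> ends G e" "y \<in> B" by blast
      obtain p q where pq: "ends G e = {p, q}" using edge_endsE[OF assms(1) e] by metis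
      have "x \<noteq> y" using xy unfolding B_def by blast
      then have "ends G e = {x, y}" using pq xy by auto
      then have "(x, y) \<in> adjacency (del_verts G X)"
        using e xy unfolding adjacency_def del_verts_def A_def B_def by auto
      then have "(a, y) \<in> ?R" using xy(2) unfolding A_def by (auto intro: rtrancl_into_rtrancl)
      then show False using xy(4) unfolding A_def B_def by blast
    qed
  qed
qed

lemma three_connected_if_tight_cuts_trivial:
  assumes G: "r_graph r G" "r \<ge> 1" and nb: "\<not> bipartite G"
    and tight: "\<And>X. X \<subseteq> verts G \<Longrightarrow> odd (card X) \<Longrightarrow> card (edge_boundary G X) = r \<Longrightarrow>
      card X = 1 \<or> card (verts G - X) = 1"
  shows "vertex_connected 3 G"
proof -
  note wf = r_graphD(1)[OF G(1)] and fin = r_graphD(2,3)[OF G(1)] and con = r_graphD(4)[OF G(1)]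
  have reg: "regular_graph r G" using G unfolding r_graph_def by blast
  have ev: "even (card (verts G))" using even_card_verts[OF G] .
  \<comment> \<open>The definition also demands more than three vertices. As the number is even,
    only 0 and 2 must be excluded, and two vertices would make \<open>G\<close> bipartite.\<close>
  have "card (verts G) \<noteq> 0" using con fin(1) unfolding graph_connected_def by simp
  moreover have "card (verts G) \<noteq> 2"
  proof
    assume "card (verts G) = 2"
    then obtain x y where xy: "verts G = {x, y}" "x \<noteq> y" unfolding card_2_iff by blast
    have "ends G e = {x, y}" if e: "e \<in> edges G" for e
      using edge_endsE[OF wf e] xy by (metis insert_absorb insert_commute insert_iff singletonD)
    then have "bipartite G" unfolding bipartite_def using xy by (intro exI[of _ "{x}"] exI[of _ "{y}"]) auto
    then show False using nb by blast
  qed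
  ultimately have big: "card (verts G) > 3" using ev by presburger
  have "graph_connected (del_verts G X)" if X: "X \<subseteq> verts G" "card X < 3" for X
  proof (rule ccontr)
    assume "\<not> graph_connected (del_verts G X)"
    have finX: "finite X" using X(1) fin(1) finite_subset by blast
    have "verts G - X \<noteq> {}" using X big finX card_mono[of X "verts G"] by auto
    obtain A B where AB: "A \<union> B = verts G - X" "A \<inter> B = {}" "A \<noteq> {}" "B \<noteq> {}"
      and sep: "\<And>e. e \<in> edges G \<Longrightarrow> ends G e \<inter> A = {} \<or> ends G e \<inter> B = {}"
      using disconnected_split[OF wf \<open>\<not> graph_connected (del_verts G X)\<close> \<open>verts G - X \<noteq> {}\<close>] by blast
    have AV: "A \<subset> verts G" "B \<subset> verts G" using AB by blast+
    have finAB: "finite A" "finite B" using AV fin(1) finite_subset by blast+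
    have "verts G = A \<union> B \<union> X" "(A \<union> B) \<inter> X = {}" using AB(1) X(1) by blast+
    then have cardV: "card (verts G) = card A + card B + card X"
      using finAB finX AB(2) by (simp add: card_Un_disjoint)
    have toX: "ends G e \<subseteq> A \<union> X" if "e \<in> edges G" "ends G e \<inter> A \<noteq> {}" for e
      using sep[OF that(1)] that wf AB(1) unfolding wf_multigraph_def by blast
    have toX': "ends G e \<subseteq> B \<union> X" if "e \<in> edges G" "ends G e \<inter> B \<noteq> {}" for e
      using sep[OF that(1)] that wf AB(1) unfolding wf_multigraph_def by blast
    have bA: "e \<in> incident_edges G X \<and> ends G e \<inter> A \<noteq> {}" if "e \<in> edge_boundary G A" for e
    proof -
      have e: "e \<in> edges G" using that by (rule edge_boundary_edge)
      obtain a b where ab: "ends G e = {a, b}" "a \<noteq> b" using edge_endsE[OF wf e] by metis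
      then show ?thesis using that edge_boundary_iff[OF e ab, of A] toX[OF e] e
        unfolding incident_edges_def by auto
    qed
    have bB: "e \<in> incident_edges G X \<and> ends G e \<inter> B \<noteq> {}" if "e \<in> edge_boundary G B" for e
    proof -
      have e: "e \<in> edges G" using that by (rule edge_boundary_edge)
      obtain a b where ab: "ends G e = {a, b}" "a \<noteq> b" using edge_endsE[OF wf e] by metis
      then show ?thesis using that edge_boundary_iff[OF e ab, of B] toX'[OF e] e
        unfolding incident_edges_def by auto
    qed
    have finb: "finite (edge_boundary G Z)" for Z using finite_subset[OF edge_boundary_subset fin(2)] .
    have "edge_boundary G A \<inter> edge_boundary G B = {}"
    proof (rule ccontr)
      assume "edge_boundary G A \<inter> edge_boundary G B \<noteq> {}"
      then obtain e where e: "e \<in> edge_boundary G A" "e \<in> edge_boundary G B" by blast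
      have "e \<in> edges G" using e(1) by (rule edge_boundary_edge)
      then show False using sep bA[OF e(1)] bB[OF e(2)] by blast
    qed
    then have "card (edge_boundary G A) + card (edge_boundary G B) = card (edge_boundary G A \<union> edge_boundary G B)"
      using finb by (simp add: card_Un_disjoint)
    also have "\<dots> \<le> card (incident_edges G X)"
      using bA bB fin(2) by (intro card_mono) (auto simp: incident_edges_def)
    also have "\<dots> \<le> r * card X" by (rule card_incident_edges_le[OF wf reg X(1)])
    finally have sum: "card (edge_boundary G A) + card (edge_boundary G B) \<le> r * card X" .
    have "edge_boundary G A \<noteq> {}" "edge_boundary G B \<noteq> {}"
      using connected_edge_boundary[OF wf con] AV AB(3,4) by blast+
    then have pos: "card (edge_boundary G A) > 0" "card (edge_boundary G B) > 0"
      using finb by (simp_all add: card_gt_0_iff)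
    have oddge: "odd (card A) \<Longrightarrow> r \<le> card (edge_boundary G A)" "odd (card B) \<Longrightarrow> r \<le> card (edge_boundary G B)"
      using r_graphD(6)[OF G(1)] AV by blast+
    \<comment> \<open>Both boundaries are nonempty, and together they have at most
      \<open>r * card X\<close> edges. For a cut vertex one part is odd and takes all
      \<open>r\<close> edges, leaving none for the other.\<close>
    consider "card X = 0" | "card X = 1" | "card X = 2" using X(2) by linarith
    then show False
    proof cases
      case 1
      then show False using sum pos by simp
    next
      case 2
      then have "odd (card A) \<or> odd (card B)" using cardV ev by presburger
      then show False using oddge sum pos 2 by auto
    next
      case 3
      then obtain u v where uv: "X = {u, v}" "u \<noteq> v" unfolding card_2_iff by blast
      show False
      proof (cases "odd (card A)")
        case True
        then have oddB: "odd (card B)" using cardV ev 3 by presburger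
        have fam: "odd_family (ends G ` edges G) (verts G) X {A, B}"
          unfolding odd_family_def
        proof (intro conjI ballI impI)
          show "X \<subseteq> verts G" by fact
          show "pairwise disjnt {A, B}" using AB(2) unfolding pairwise_def disjnt_def by blast
          fix C assume C: "C \<in> {A, B}"
          show "C \<subseteq> verts G - X" "odd (card C)" using C AB(1) True oddB by blast+
          fix x assume x: "x \<in> ends G ` edges G" "x \<subseteq> verts G \<and> x \<inter> C \<noteq> {}"
          then show "x \<subseteq> C \<union> X" using toX toX' C by blast
        qed
        have "A \<noteq> B" using AB(2,3) by blast
        then have "card {A, B} = 2" by simp
        then have "bipartite G"
          by (intro barrier_bipartite[OF G(1) fam _ _ G(2) tight]) (use 3 in simp_all)
        then show False using nb by blast
      next
        case False
        then have evB: "even (card B)" using cardV ev 3 by presburger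
        have uvAB: "u \<notin> A" "v \<notin> A" "u \<notin> B" "v \<notin> B" "u \<in> verts G" "v \<in> verts G"
          using AB(1) uv X(1) by blast+
        let ?P = "edge_boundary G (insert u A)" and ?Q = "edge_boundary G (insert v A)"
        let ?u = "edge_boundary G {u}" and ?v = "edge_boundary G {v}"
        \<comment> \<open>Uncrossing: no edge joins \<open>A\<close> to \<open>B\<close>, so an edge
          between \<open>u\<close> and \<open>v\<close> lies in all four cuts, and any other edge of
          \<open>?P\<close> or \<open>?Q\<close> lies in exactly one of them and in exactly one
          star. Hence the two cuts have at most \<open>2 * r\<close> edges in total, while each,
          being odd, has at least \<open>r\<close>.\<close>
        have cut: "(e \<in> ?P \<or> e \<in> ?Q \<longrightarrow> e \<in> ?u \<or> e \<in> ?v) \<and> (e \<in> ?P \<and> e \<in> ?Q \<longrightarrow> e \<in> ?u \<and> e \<in> ?v)"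
          if e: "e \<in> edges G" for e
        proof -
          obtain a b where ab: "ends G e = {a, b}" "a \<noteq> b" and "a \<in> verts G" "b \<in> verts G"
            using edge_endsE[OF wf e] by metis
          then have "a \<in> A \<or> a \<in> B \<or> a = u \<or> a = v" "b \<in> A \<or> b \<in> B \<or> b = u \<or> b = v"
            using AB(1) uv(1) by blast+
          moreover have "\<not> (a \<in> A \<and> b \<in> B)" "\<not> (a \<in> B \<and> b \<in> A)" using sep[OF e] ab(1) by auto
          ultimately show ?thesis
            unfolding edge_boundary_iff[OF e ab] using ab(2) uvAB uv(2) AB(2) by auto
        qed
        have sub: "?P \<union> ?Q \<subseteq> ?u \<union> ?v" "?P \<inter> ?Q \<subseteq> ?u \<inter> ?v"
          using cut edge_boundary_subset[of G "insert u A"] edge_boundary_subset[of G "insert v A"] by blast+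
        have "card ?P + card ?Q = card (?P \<union> ?Q) + card (?P \<inter> ?Q)" by (rule card_Un_Int[OF finb finb])
        also have "\<dots> \<le> card (?u \<union> ?v) + card (?u \<inter> ?v)"
          using sub finb by (intro add_mono card_mono) auto
        also have "\<dots> = card ?u + card ?v" by (rule card_Un_Int[OF finb finb, symmetric])
        also have "\<dots> = 2 * r" using r_graphD(5)[OF G(1)] uvAB by simp
        finally have le: "card ?P + card ?Q \<le> 2 * r" .
        have oddu: "odd (card (insert u A))" "odd (card (insert v A))"
          using False uvAB finAB by simp_all
        have sub': "insert u A \<subseteq> verts G" "insert v A \<subseteq> verts G" using AV uvAB by blast+
        have "r \<le> card ?P" "r \<le> card ?Q" using r_graphD(6)[OF G(1)] oddu sub' by blast+
        then have "card ?P = r" using le by linarith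
        \<comment> \<open>Neither shore is a single vertex, because \<open>A\<close> and
          \<open>B\<close> are nonempty and \<open>insert v B\<close> lies in the complement of
          \<open>insert u A\<close>.\<close>
        then consider "card (insert u A) = 1" | "card (verts G - insert u A) = 1"
          using tight[OF sub'(1) oddu(1)] by blast
        then show False
        proof cases
          case 1
          then show False using uvAB(1) AB(3) finAB(1) by simp
        next
          case 2
          have "insert v B \<subseteq> verts G - insert u A" using uvAB uv AV AB(2) by blast
          then have "card (insert v B) \<le> 1" using 2 fin(1) card_mono by (metis finite_Diff)
          then show False using uvAB(4) AB(4) finAB(2) by simp
        qed
      qed
    qed
  qed
  then show ?thesis unfolding vertex_connected_def using big by blast
qed

lemma brick_if_tight_cuts_trivial:
  assumes "r_graph r G" "r \<ge> 1" "\<not> bipartite G"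
    and "\<And>X. X \<subseteq> verts G \<Longrightarrow> odd (card X) \<Longrightarrow> card (edge_boundary G X) = r \<Longrightarrow>
      card X = 1 \<or> card (verts G - X) = 1"
  shows "brick G"
  unfolding brick_def
  using r_graphD(1)[OF assms(1)] assms(3) bicritical_if_tight_cuts_trivial[OF assms]
    three_connected_if_tight_cuts_trivial[OF assms] by blast

section \<open>Minimal counterexamples\<close>

text \<open>Both shores are odd and not singletons, hence have at least three vertices; replacing
  either by one vertex makes the graph strictly smaller.\<close>

lemma nontrivial_shore_cards:
  assumes "r_graph r G" "X \<subseteq> verts G" "odd (card X)" "r \<ge> 1"
    and "card X \<noteq> 1" "card (verts G - X) \<noteq> 1"
  shows "X \<subset> verts G" "card X + 1 < card (verts G)" "card (verts G - X) + 1 < card (verts G)"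
proof -
  note fin = r_graphD(2)[OF assms(1)]
  have "card (verts G) = card X + card (verts G - X)"
    using assms(2) fin by (metis card_Diff_subset card_mono finite_subset le_add_diff_inverse)
  moreover have oddc: "odd (card (verts G - X))" using odd_complement[OF assms(1,4,2,3)] .
  ultimately show "card X + 1 < card (verts G)" "card (verts G - X) + 1 < card (verts G)"
    using assms(3,5,6) by presburger+
  show "X \<subset> verts G" using assms(2) oddc by auto
qed

text \<open>Competitors \<open>H\<close> range over graphs on natural numbers, which loses no
  generality for finite graphs. In both parts a nontrivial tight cut yields two smaller r-graphs
  with the same \<open>r\<close>, which minimality makes colorable or coverable, and gluing
  contradicts the choice of \<open>G\<close>.\<close>

theorem theorem4:
  fixes G :: "('v, 'e) multigraph" and r :: nat
  assumes "r \<ge> 1" and "r_graph r G"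
  shows
    "(\<not> edge_colorable (r + 1) G \<and>
      (\<forall>(H :: (nat, nat) multigraph) (s :: nat).
         s \<ge> 1 \<and> r_graph s H \<and> \<not> edge_colorable (s + 1) H \<longrightarrow>
         card (verts G) \<le> card (verts H))
      \<longrightarrow> brick G) \<and>
     (\<not> has_double_cover r G \<and>
      (\<forall>(H :: (nat, nat) multigraph) (s :: nat).
         s \<ge> 1 \<and> r_graph s H \<and> \<not> has_double_cover s H \<longrightarrow>
         card (verts G) \<le> card (verts H))
      \<longrightarrow> brick G)"
proof -
  note wf = r_graphD(1)[OF assms(2)]
  have reg: "regular_graph r G" using assms(2) unfolding r_graph_def by blast
  have brick_a: "brick G" if A: "\<not> edge_colorable (r + 1) G \<and>
      (\<forall>(H :: (nat, nat) multigraph) (s :: nat).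
         s \<ge> 1 \<and> r_graph s H \<and> \<not> edge_colorable (s + 1) H \<longrightarrow>
         card (verts G) \<le> card (verts H))"
  proof (rule brick_if_tight_cuts_trivial[OF assms(2,1)])
      show "\<not> bipartite G"
      proof
        assume "bipartite G"
        then have "edge_colorable r G" by (rule bipartite_regular_edge_colorable[OF wf reg])
        then have "edge_colorable (r + 1) G"
          unfolding edge_colorable_def by (metis add.commute less_SucI plus_1_eq_Suc)
        then show False using A by blast
      qed
      fix X assume X: "X \<subseteq> verts G" "odd (card X)" "card (edge_boundary G X) = r"
      show "card X = 1 \<or> card (verts G - X) = 1"
      proof (rule ccontr)
        assume "\<not> ?thesis"
        then have shore: "X \<subset> verts G" "card X + 1 < card (verts G)" "card (verts G - X) + 1 < card (verts G)"
          using nontrivial_shore_cards[OF assms(2) X(1,2) assms(1)] by blast+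
        have "edge_colorable (r + 1) G"
        proof (rule merge_coloring[OF assms(2,1) shore(1) X(2,3)])
          fix H :: "(nat, nat) multigraph"
          assume H: "r_graph r H" "card (verts H) = card X + 1 \<or> card (verts H) = card (verts G - X) + 1"
          then have "\<not> card (verts G) \<le> card (verts H)" using shore by auto
          then show "edge_colorable (r + 1) H" using A H(1) assms(1) by blast
        qed
        then show False using A by blast
      qed
    qed
  have brick_b: "brick G" if A: "\<not> has_double_cover r G \<and>
      (\<forall>(H :: (nat, nat) multigraph) (s :: nat).
         s \<ge> 1 \<and> r_graph s H \<and> \<not> has_double_cover s H \<longrightarrow>
         card (verts G) \<le> card (verts H))"
  proof (rule brick_if_tight_cuts_trivial[OF assms(2,1)])
      show "\<not> bipartite G"
      proof
        assume "bipartite G"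
        then have "has_double_cover r G"
          using bipartite_regular_edge_colorable[OF wf reg] regular_edge_colorable_double_cover[OF wf reg] by blast
        then show False using A by blast
      qed
      fix X assume X: "X \<subseteq> verts G" "odd (card X)" "card (edge_boundary G X) = r"
      show "card X = 1 \<or> card (verts G - X) = 1"
      proof (rule ccontr)
        assume "\<not> ?thesis"
        then have shore: "X \<subset> verts G" "card X + 1 < card (verts G)" "card (verts G - X) + 1 < card (verts G)"
          using nontrivial_shore_cards[OF assms(2) X(1,2) assms(1)] by blast+
        have "has_double_cover r G"
        proof (rule merge_double_cover[OF assms(2,1) shore(1) X(2,3)])
          fix H :: "(nat, nat) multigraph"
          assume H: "r_graph r H" "card (verts H) = card X + 1 \<or> card (verts H) = card (verts G - X) + 1"
          then have "\<not> card (verts G) \<le> card (verts H)" using shore by auto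
          then show "has_double_cover r H" using A H(1) assms(1) by blast
        qed
        then show False using A by blast
      qed
    qed
  show ?thesis using brick_a brick_b by (intro conjI impI)
qed

end
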